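(* Let $H<\mathrm{GL}(d,\mathbb{R})$ be an admissible dilation group with open dual orbit $\mathcal{O}$, let $G=\mathbb{R}^d\rtimes H$ and let $\pi$ be the (square-integrable, irreducible) quasi-regular representation of $G$ on $L^2(\mathbb{R}^d)$. Let $v$ be a weight on $G$ satisfying $v(x,h)\le (1+|x|)^s w(h)$ for all $(x,h)\in G$, for some $s\ge 0$ and some weight $w$ on $H$. Then $\pi$ is $v$-integrable, i.e. there exists a nonzero $\psi\in L^2(\mathbb{R}^d)$ with $\mathcal{W}_\psi\psi\in L^1_v(G)$. In fact, if $\psi\in\mathcal{F}^{-1}C_c^\infty(\mathcal{O})$, then $\mathcal{W}_\psi\psi\in L^1_v(G)$.
   Context: Let $d>1$ and let $H$ be a closed subgroup of $\mathrm{GL}(d,\mathbb{R})$. $G=\mathbb{R}^d\rtimes H$ has product $(x,h)(y,g)=(x+hy,hg)$ and left Haar measure $|\det h|^{-1}\,dx\,dh$, with $dh$ left Haar measure on $H$. The quasi-regular representation is $[\pi(x,h)f](y)=|\det h|^{-1/2}f(h^{-1}(y-x))$ on $L^2(\mathbb{R}^d)$. $H$ is called an admissible dilation group if $\pi$ is irreducible and square-integrable, the latter meaning that there is a nonzero $\psi\in L^2(\mathbb{R}^d)$ with $(x,h)\mapsto\langle\psi,\pi(x,h)\psi\rangle$ in $L^2(G)$. It is known that this holds iff the dual action $(\xi,h)\mapsto h^T\xi$ has a single open orbit $\mathcal{O}=\{h^T\xi_0:h\in H\}\subset\mathbb{R}^d$ of full Lebesgue measure, with compact stabilizers $\{h\in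 H: h^T\xi_0=\xi_0\}$; $\mathcal{O}$ is called the open dual orbit. The wavelet transform is $\mathcal{W}_\psi f(x,h)=\langle f,\pi(x,h)\psi\rangle$. The Fourier transform is $\mathcal{F}f(\xi)=\widehat f(\xi)=\int f(x)e^{-2\pi i\langle x,\xi\rangle}dx$. $C_c^\infty(\mathcal{O})$ is the space of $f\in C_c^\infty(\mathbb{R}^d)$ with support contained in $\mathcal{O}$, and $\mathcal{F}^{-1}C_c^\infty(\mathcal{O})$ is its inverse image under the Fourier transform. $|\cdot|$ is the euclidean norm on $\mathbb{R}^d$. A weight on a locally compact group is a continuous positive function $v$ with $v(g_1g_2)\le v(g_1)v(g_2)$ for all $g_1,g_2$. $L^1_v(G)$ is the space of measurable $F$ with $\int_H\int_{\mathbb{R}^d}|F(x,h)|v(x,h)\,dx\,\frac{dh}{|\det h|}<\infty$. *)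

theory Defs
  imports "HOL-Analysis.Analysis"
begin

definition closed_subgroup_GL :: "(real^'n^'n) set \<Rightarrow> bool" where
  "closed_subgroup_GL H \<longleftrightarrow>
     H \<subseteq> {h. invertible h} \<and> mat 1 \<in> H \<and>
     (\<forall>h\<in>H. \<forall>g\<in>H. h ** g \<in> H) \<and> (\<forall>h\<in>H. matrix_inv h \<in> H) \<and>
     closedin (top_of_set {h. invertible h}) H"

text \<open>
  \<open>H\<close> is second countable and locally compact, so every Borel measure on it that is finite on
  compact sets is a Radon measure; no separate regularity condition is needed.
\<close>

definition left_Haar_measure :: "(real^'n^'n) set \<Rightarrow> (real^'n^'n) measure \<Rightarrow> bool" where
  "left_Haar_measure H \<mu> \<longleftrightarrow>
     sets \<mu> = sets (restrict_space borel H) \<and>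
     emeasure \<mu> H \<noteq> 0 \<and>
     (\<forall>K. compact K \<and> K \<subseteq> H \<longrightarrow> emeasure \<mu> K < \<infinity>) \<and>
     (\<forall>h\<in>H. \<forall>A\<in>sets \<mu>. emeasure \<mu> ((\<lambda>g. h ** g) ` A) = emeasure \<mu> A)"

text \<open>
  The group \<open>G\<close> is represented by its carrier \<open>UNIV \<times> H\<close>, the product \<open>sd_mult\<close> and the
  measure \<open>Haar_G \<mu>\<close>, where \<open>\<mu>\<close> is a left Haar measure on \<open>H\<close>.
\<close>

definition sd_mult ::
  "(real^'n) \<times> (real^'n^'n) \<Rightarrow> (real^'n) \<times> (real^'n^'n) \<Rightarrow> (real^'n) \<times> (real^'n^'n)" where
  "sd_mult = (\<lambda>(x, h) (y, g). (x + h *v y, h ** g))"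

definition Haar_G :: "(real^'n^'n) measure \<Rightarrow> ((real^'n) \<times> (real^'n^'n)) measure" where
  "Haar_G \<mu> = density (lborel \<Otimes>\<^sub>M \<mu>) (\<lambda>(x, h). ennreal (1 / \<bar>det h\<bar>))"

definition weight_on :: "'g::topological_space set \<Rightarrow> ('g \<Rightarrow> 'g \<Rightarrow> 'g) \<Rightarrow> ('g \<Rightarrow> real) \<Rightarrow> bool" where
  "weight_on S m v \<longleftrightarrow>
     continuous_on S v \<and> (\<forall>g\<in>S. 0 < v g) \<and> (\<forall>g1\<in>S. \<forall>g2\<in>S. v (m g1 g2) \<le> v g1 * v g2)"

text \<open>
  Elements of \<open>L\<^sup>2\<close> are functions, not classes modulo null sets. Accordingly a nonzero element is
  one that is not almost everywhere zero, and closed subspaces are closed for the seminorm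
  \<open>L2_norm\<close>, hence saturated under almost everywhere equality.
\<close>

definition L2 :: "'a measure \<Rightarrow> ('a \<Rightarrow> complex) set" where
  "L2 M = {f \<in> borel_measurable M. integrable M (\<lambda>x. (cmod (f x))\<^sup>2)}"

definition L2_inner :: "'a measure \<Rightarrow> ('a \<Rightarrow> complex) \<Rightarrow> ('a \<Rightarrow> complex) \<Rightarrow> complex" where
  "L2_inner M f g = (LINT x|M. f x * cnj (g x))"

definition L2_norm :: "'a measure \<Rightarrow> ('a \<Rightarrow> complex) \<Rightarrow> real" where
  "L2_norm M f = sqrt (LINT x|M. (cmod (f x))\<^sup>2)"

definition closed_L2_subspace :: "'a measure \<Rightarrow> ('a \<Rightarrow> complex) set \<Rightarrow> bool" where
  "closed_L2_subspace M V \<longleftrightarrow>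
     V \<subseteq> L2 M \<and> (\<lambda>x. 0) \<in> V \<and>
     (\<forall>f\<in>V. \<forall>g\<in>V. (\<lambda>x. f x + g x) \<in> V) \<and>
     (\<forall>c. \<forall>f\<in>V. (\<lambda>x. c * f x) \<in> V) \<and>
     (\<forall>f\<in>L2 M. (\<forall>e>0. \<exists>g\<in>V. L2_norm M (\<lambda>x. f x - g x) < e) \<longrightarrow> f \<in> V)"

definition qreg :: "(real^'n) \<times> (real^'n^'n) \<Rightarrow> (real^'n \<Rightarrow> complex) \<Rightarrow> (real^'n \<Rightarrow> complex)" where
  "qreg = (\<lambda>(x, h) f y. complex_of_real (\<bar>det h\<bar> powr (- 1 / 2)) * f (matrix_inv h *v (y - x)))"

definition wavelet_transform ::
  "(real^'n \<Rightarrow> complex) \<Rightarrow> (real^'n \<Rightarrow> complex) \<Rightarrow> (real^'n) \<times> (real^'n^'n) \<Rightarrow> complex" where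
  "wavelet_transform \<psi> f g = L2_inner lborel f (qreg g \<psi>)"

definition qreg_irreducible :: "(real^'n^'n) set \<Rightarrow> bool" where
  "qreg_irreducible H \<longleftrightarrow>
     (\<forall>V. closed_L2_subspace lborel V \<and> (\<forall>g \<in> UNIV \<times> H. \<forall>f\<in>V. qreg g f \<in> V) \<longrightarrow>
        V = {f \<in> L2 lborel. AE x in lborel. f x = 0} \<or> V = L2 lborel)"

definition qreg_square_integrable :: "(real^'n^'n) measure \<Rightarrow> bool" where
  "qreg_square_integrable \<mu> \<longleftrightarrow>
     (\<exists>\<psi>\<in>L2 lborel. \<not> (AE x in lborel. \<psi> x = 0) \<and> wavelet_transform \<psi> \<psi> \<in> L2 (Haar_G \<mu>))"

text \<open>
  \<open>\<mu>\<close> is the chosen left Haar measure on \<open>H\<close>. By uniqueness of Haar measure up to a positive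
  factor, the condition does not depend on the choice.
\<close>

definition admissible_dilation_group :: "(real^'n^'n) set \<Rightarrow> (real^'n^'n) measure \<Rightarrow> bool" where
  "admissible_dilation_group H \<mu> \<longleftrightarrow>
     closed_subgroup_GL H \<and> left_Haar_measure H \<mu> \<and>
     qreg_irreducible H \<and> qreg_square_integrable \<mu>"

text \<open>
  An open orbit with null complement is the only open orbit, since any other one would be an open
  nonempty null set.
\<close>

definition open_dual_orbit :: "(real^'n^'n) set \<Rightarrow> (real^'n) set \<Rightarrow> bool" where
  "open_dual_orbit H Orb \<longleftrightarrow>
     (\<exists>\<xi>0. Orb = {transpose h *v \<xi>0 |h. h \<in> H} \<and> open Orb \<and> - Orb \<in> null_sets lborel \<and>
        compact {h \<in> H. transpose h *v \<xi>0 = \<xi>0})"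

definition fourier :: "(real^'n \<Rightarrow> complex) \<Rightarrow> (real^'n \<Rightarrow> complex)" where
  "fourier f \<xi> = (LINT x|lborel. f x * exp (- 2 * complex_of_real pi * \<i> * complex_of_real (x \<bullet> \<xi>)))"

primrec Ck :: "nat \<Rightarrow> ('a::real_normed_vector \<Rightarrow> 'b::real_normed_vector) \<Rightarrow> bool" where
  "Ck 0 f \<longleftrightarrow> continuous_on UNIV f"
| "Ck (Suc k) f \<longleftrightarrow>
     (\<forall>x. f differentiable at x) \<and> (\<forall>u. Ck k (\<lambda>x. frechet_derivative f (at x) u))"

definition Cc_infinity :: "(real^'n) set \<Rightarrow> (real^'n \<Rightarrow> complex) set" where
  "Cc_infinity U =
     {f. (\<forall>k. Ck k f) \<and> compact (closure {x. f x \<noteq> 0}) \<and> closure {x. f x \<noteq> 0} \<subseteq> U}"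

text \<open>
  The preimage of \<open>Cc_infinity U\<close> under the Fourier transform consists of Schwartz functions, up
  to null sets. So it does not matter that the preimage is taken in \<open>L\<^sup>1\<close>, where the integral
  formula applies, instead of \<open>L\<^sup>2\<close>. Integrability has to be required explicitly because the
  Bochner integral of a non-integrable function is \<open>0\<close> by convention.
\<close>

definition Finv_Cc_infinity :: "(real^'n) set \<Rightarrow> (real^'n \<Rightarrow> complex) set" where
  "Finv_Cc_infinity U = {\<psi>. integrable lborel \<psi> \<and> fourier \<psi> \<in> Cc_infinity U}"

definition L1_weighted ::
  "(real^'n^'n) measure \<Rightarrow> ((real^'n) \<times> (real^'n^'n) \<Rightarrow> real) \<Rightarrow>
    ((real^'n) \<times> (real^'n^'n) \<Rightarrow> complex) set" where
  "L1_weighted \<mu> v =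
     {F \<in> borel_measurable (Haar_G \<mu>).
        (\<integral>\<^sup>+h. (\<integral>\<^sup>+x. ennreal (cmod (F (x, h)) * v (x, h)) \<partial>lborel) * ennreal (1 / \<bar>det h\<bar>) \<partial>\<mu>) < \<infinity>}"

definition v_integrable ::
  "(real^'n^'n) measure \<Rightarrow> ((real^'n) \<times> (real^'n^'n) \<Rightarrow> real) \<Rightarrow> bool" where
  "v_integrable \<mu> v \<longleftrightarrow>
     (\<exists>\<psi>\<in>L2 lborel. \<not> (AE x in lborel. \<psi> x = 0) \<and> wavelet_transform \<psi> \<psi> \<in> L1_weighted \<mu> v)"

end

theory Submission
  imports Defs "HOL-Probability.Probability"
begin

text \<open>
  Write \<open>\<phi>\<close> for the Fourier transform of \<open>\<psi>\<close>. Up to the factor \<open>\<bar>det h\<bar>\<close> to the power \<open>-1/2\<close>, the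
  function \<open>W(\<cdot>, h)\<close>, where \<open>W\<close> is the wavelet transform of \<open>\<psi>\<close> by itself, is the correlation of
  \<open>\<psi>\<close> with the dilate \<open>\<psi> \<circ> h\<^sup>-\<^sup>1\<close>. This is used twice.

  On the Fourier side, correlation becomes multiplication: the transform of \<open>W(\<cdot>, h)\<close> is a constant
  times \<open>\<phi>(\<xi>)\<close> times the conjugate of \<open>\<phi>(h\<^sup>T \<xi>)\<close> (\<open>fourier_correlation\<close>). If \<open>h\<^sup>T\<close> moves the support of
  \<open>\<phi>\<close> off itself, the product vanishes, and so does \<open>W(\<cdot>, h)\<close> almost everywhere, because the Fourier
  transform is injective on integrable functions (\<open>fourier_injective\<close>). The remaining \<open>h\<close> lie in a
  compact subset of \<open>H\<close>, since the action of \<open>H\<close> on its dual orbit is proper (\<open>dual_orbit_proper\<close>):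
  by the Baire category theorem every compact subset of the orbit lies in the image of a compact subset of
  \<open>H\<close>, and the stabilizer is compact.

  On the space side, \<open>(1 + \<bar>x\<bar>)\<^sup>s\<close> is submultiplicative, so the weighted \<open>L\<^sup>1\<close> norm of the correlation is
  at most the square of the weighted norm of \<open>\<psi>\<close> times a factor that is bounded for \<open>h\<close> in a compact
  set (\<open>correlation_weighted_norm\<close>). The weighted norm of \<open>\<psi>\<close> is finite because \<open>\<psi>\<close> agrees almost
  everywhere with the inverse Fourier transform of \<open>\<phi>\<close>, which decays faster than any power
  (\<open>inv_fourier_rapid_decay\<close>). Integrating over \<open>h\<close> costs only the Haar measure of a compact set.
  Smoothness of \<open>\<phi>\<close> thus enters through \<open>\<psi>\<close> alone; the uniformity in \<open>h\<close> comes from the weight.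

  A nonzero \<open>\<psi>\<close> of this kind is the inverse Fourier transform of a bump function supported in the orbit.
  Inversion and injectivity of the Fourier transform both come from one identity,
  \<open>inv_fourier_gauss_mean\<close>: damping the inversion integral by a Gaussian replaces \<open>\<phi>\<close> by an average of
  \<open>\<phi>\<close> against a narrow Gaussian.
\<close>

section \<open>Linear changes of variables\<close>

lemma matrix_inv_inverse:
  fixes A :: "real^'n^'n"
  assumes "invertible A"
  shows "A ** matrix_inv A = mat 1" "matrix_inv A ** A = mat 1"
proof -
  have "A ** matrix_inv A = mat 1 \<and> matrix_inv A ** A = mat 1"
    using assms unfolding matrix_inv_def invertible_def by (rule someI_ex)
  then show "A ** matrix_inv A = mat 1" "matrix_inv A ** A = mat 1" by auto
qed

lemma matrix_inv_vector:
  fixes A :: "real^'n^'n"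
  assumes "invertible A"
  shows "A *v (matrix_inv A *v x) = x" "matrix_inv A *v (A *v x) = x"
  by (simp_all add: matrix_vector_mul_assoc matrix_inv_inverse[OF assms])

lemma transpose_vector_inverse:
  fixes A B :: "real^'n^'n"
  assumes "A ** B = mat 1"
  shows "transpose B *v (transpose A *v x) = x"
  by (metis assms matrix_transpose_mul matrix_vector_mul_assoc matrix_vector_mul_lid transpose_mat)

lemma continuous_on_det:
  fixes f :: "'a::topological_space \<Rightarrow> real^'n^'n"
  assumes "\<And>i j. continuous_on S (\<lambda>x. f x $ i $ j)"
  shows "continuous_on S (\<lambda>x. det (f x))"
  unfolding det_def by (intro continuous_intros assms)

text \<open>
  Cramer's rule applied to the columns of the identity writes the inverse through determinants,
  which are polynomials in the entries; continuity of inversion follows.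
\<close>

lemma matrix_inv_cramer:
  fixes A :: "real^'n^'n"
  assumes "invertible A"
  shows "matrix_inv A = (\<chi> k j. det (\<chi> i l. if l = k then axis j 1 $ i else A $ i $ l) / det A)"
proof -
  have d: "det A \<noteq> 0" using assms by (simp add: invertible_det_nz)
  have "matrix_inv A $ k $ j = det (\<chi> i l. if l = k then axis j 1 $ i else A $ i $ l) / det A" for k j
  proof -
    have "A *v (matrix_inv A *v axis j 1) = axis j 1"
      by (rule matrix_inv_vector[OF assms])
    then have "matrix_inv A *v axis j 1 = (\<chi> k. det (\<chi> i l. if l = k then axis j 1 $ i else A $ i $ l) / det A)"
      using cramer[OF d] by blast
    then have "(matrix_inv A *v axis j 1) $ k = det (\<chi> i l. if l = k then axis j 1 $ i else A $ i $ l) / det A"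
      by simp
    then show ?thesis by (simp add: matrix_vector_mul_component inner_axis column_def)
  qed
  then show ?thesis by (simp add: vec_eq_iff)
qed

lemma continuous_on_matrix_inv: "continuous_on {A::real^'n^'n. invertible A} matrix_inv"
proof -
  have "continuous_on {A::real^'n^'n. invertible A}
     (\<lambda>A. \<chi> k j. det (\<chi> i l. if l = k then axis j 1 $ i else A $ i $ l) / det A)"
  proof (intro continuous_on_vec_lambda continuous_on_divide continuous_on_det)
    fix k j i l :: 'n
    show "continuous_on {A. invertible A}
           (\<lambda>A::real^'n^'n. (\<chi> i l. if l = k then axis j 1 $ i else A $ i $ l) $ i $ l)"
      by (cases "l = k") (auto intro!: continuous_intros)
    show "continuous_on {A. invertible A} (\<lambda>A::real^'n^'n. A $ i $ j)"
      by (intro continuous_intros)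
  qed (simp add: invertible_det_nz)
  then show ?thesis
    by (rule continuous_on_eq) (simp add: matrix_inv_cramer)
qed

text \<open>
  Integrate the indicator of \<open>x + y \<in> A\<close>, \<open>y \<in> B\<close> over \<open>M \<Otimes> lborel\<close> in both orders. Invariance of
  \<open>M\<close> evaluates one order to \<open>M(A) lborel(B)\<close>; invariance of Lebesgue measure, which turns \<open>y\<close>
  into \<open>y - x\<close>, evaluates the other to \<open>lborel(A) M(-B)\<close>. A symmetric \<open>B\<close> of volume \<open>1\<close> gives the
  claim.
\<close>

lemma translation_invariant_measure_unique:
  fixes M :: "'a::euclidean_space measure"
  assumes sets: "sets M = sets borel"
    and fin: "\<And>K. compact K \<Longrightarrow> emeasure M K < \<infinity>"
    and inv: "\<And>x A. A \<in> sets borel \<Longrightarrow> emeasure M ((\<lambda>y. y + x) -` A) = emeasure M A"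
    and B: "B \<in> sets borel" "uminus ` B = B" "emeasure lborel B = 1"
    and A: "A \<in> sets borel"
  shows "emeasure M A = emeasure M B * emeasure lborel A"
proof -
  have space: "space M = UNIV" using sets_eq_imp_space_eq[OF sets] by simp
  interpret M: sigma_finite_measure M
  proof
    show "\<exists>\<A>. countable \<A> \<and> \<A> \<subseteq> sets M \<and> \<Union> \<A> = space M \<and> (\<forall>a\<in>\<A>. emeasure M a \<noteq> \<infinity>)"
    proof (intro exI conjI ballI)
      show "countable (range (\<lambda>n::nat. cball (0::'a) (real n)))" by simp
      show "range (\<lambda>n::nat. cball (0::'a) (real n)) \<subseteq> sets M" by (auto simp: sets)
      show "\<Union> (range (\<lambda>n::nat. cball (0::'a) (real n))) = space M"
        by (auto simp: space real_arch_simple)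
      show "emeasure M a \<noteq> \<infinity>" if "a \<in> range (\<lambda>n::nat. cball (0::'a) (real n))" for a
        using that fin[OF compact_cball] by (auto simp: less_top[symmetric])
    qed
  qed
  interpret P: pair_sigma_finite M lborel ..
  note [measurable_cong] = sets
  note [measurable] = A B(1)
  have B': "- y \<in> B \<longleftrightarrow> y \<in> B" for y
    using B(2) by (metis image_eqI add.inverse_inverse)
  have "emeasure M A * emeasure lborel B = (\<integral>\<^sup>+y. (\<integral>\<^sup>+x. indicator A (x + y) * indicator B y \<partial>M) \<partial>lborel)"
  proof -
    have "(\<integral>\<^sup>+x. indicator A (x + y) * indicator B y \<partial>M) = emeasure M A * indicator B y" for y
    proof -
      have "(\<integral>\<^sup>+x. indicator A (x + y) * indicator B y \<partial>M) = (\<integral>\<^sup>+x. indicator ((\<lambda>x. x + y) -` A) x \<partial>M) * indicator B y"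
        by (subst nn_integral_multc) (simp_all add: indicator_def[abs_def] vimage_def)
      also have "(\<integral>\<^sup>+x. indicator ((\<lambda>x. x + y) -` A) x \<partial>M) = emeasure M ((\<lambda>x. x + y) -` A)"
        by (rule nn_integral_indicator) (simp add: sets measurable_sets_borel[of _ borel])
      finally show ?thesis by (simp add: inv A)
    qed
    then show ?thesis by (simp add: nn_integral_cmult)
  qed
  also have "\<dots> = (\<integral>\<^sup>+x. (\<integral>\<^sup>+y. indicator A (x + y) * indicator B y \<partial>lborel) \<partial>M)"
    by (rule P.Fubini') simp
  also have "\<dots> = (\<integral>\<^sup>+x. (\<integral>\<^sup>+y. indicator A y * indicator B (y - x) \<partial>lborel) \<partial>M)"
  proof (rule nn_integral_cong)
    fix x
    have "(\<integral>\<^sup>+y. indicator A y * indicator B (y - x) \<partial>lborel) = (\<integral>\<^sup>+y. indicator A y * indicator B (y - x) \<partial>distr lborel borel ((+) x))"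
      by (simp add: lborel_distr_plus)
    then show "(\<integral>\<^sup>+y. indicator A (x + y) * indicator B y \<partial>lborel) = (\<integral>\<^sup>+y. indicator A y * indicator B (y - x) \<partial>lborel)"
      by (simp add: nn_integral_distr)
  qed
  also have "\<dots> = (\<integral>\<^sup>+y. (\<integral>\<^sup>+x. indicator A y * indicator B (y - x) \<partial>M) \<partial>lborel)"
    by (rule P.Fubini'[symmetric]) simp
  also have "\<dots> = emeasure M B * emeasure lborel A"
  proof -
    have "(\<integral>\<^sup>+x. indicator A y * indicator B (y - x) \<partial>M) = emeasure M B * indicator A y" for y
    proof -
      have "(\<integral>\<^sup>+x. indicator A y * indicator B (y - x) \<partial>M) = indicator A y * (\<integral>\<^sup>+x. indicator ((\<lambda>x. x + - y) -` B) x \<partial>M)"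
        using B'[of "y - _"] by (subst nn_integral_cmult) (simp_all add: indicator_def[abs_def] vimage_def)
      also have "(\<integral>\<^sup>+x. indicator ((\<lambda>x. x + - y) -` B) x \<partial>M) = emeasure M ((\<lambda>x. x + - y) -` B)"
        by (rule nn_integral_indicator) (simp add: sets measurable_sets_borel[of _ borel])
      finally show ?thesis by (simp only: inv B mult.commute)
    qed
    then show ?thesis by (simp add: nn_integral_cmult)
  qed
  finally show ?thesis using B(3) by simp
qed

text \<open>
  The factor by which \<open>A\<close> scales Lebesgue measure, that is \<open>\<bar>det A\<bar>\<close>, read off from its effect on
  the centred unit cube. The cube is centred so that it is symmetric, as the uniqueness of
  translation-invariant measures asks for. What matters below is that the factor is positive and
  bounded in terms of the norm of \<open>A\<close>.
\<close>

definition vol_scale :: "real^'n^'n \<Rightarrow> real" where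
  "vol_scale A = measure lborel ((*v) A ` cbox (\<chi> i. - (1 / 2)) (\<chi> i. 1 / 2))"

lemma borel_measurable_matrix_affine[measurable (raw)]:
  fixes A :: "real^'n^'n"
  assumes "f \<in> borel_measurable M"
  shows "(\<lambda>x. A *v f x) \<in> borel_measurable M"
  by (rule borel_measurable_continuous_on[OF _ assms]) (intro continuous_intros)

text \<open>
  The unit cube lies in the ball of radius \<open>CARD('n)\<close>, since its points have \<open>l\<^sup>1\<close> norm at most
  \<open>CARD('n) / 2\<close>.
\<close>

lemma vol_scale_le:
  fixes A :: "real^'n^'n"
  assumes "\<And>x. norm (A *v x) \<le> R * norm x" "0 \<le> R"
  shows "vol_scale A \<le> measure lborel (cball (0::real^'n) (R * CARD('n)))"
  unfolding vol_scale_def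
proof (rule measure_mono_fmeasurable)
  show "(*v) A ` cbox (\<chi> i. - (1 / 2)) (\<chi> i. 1 / 2) \<subseteq> cball 0 (R * CARD('n))"
  proof clarsimp
    fix x :: "real^'n" assume x: "x \<in> cbox (\<chi> i. - (1 / 2)) (\<chi> i. 1 / 2)"
    have "norm x \<le> (\<Sum>i\<in>UNIV. \<bar>x $ i\<bar>)" by (rule norm_le_l1_cart)
    also have "\<dots> \<le> (\<Sum>i\<in>(UNIV::'n set). 1)"
    proof (rule sum_mono)
      fix i
      have "- (1 / 2) \<le> x $ i \<and> x $ i \<le> 1 / 2" using x by (simp add: mem_box_cart)
      then show "\<bar>x $ i\<bar> \<le> 1" by linarith
    qed
    finally have "norm x \<le> CARD('n)" by simp
    with assms(1)[of x] assms(2) show "norm (A *v x) \<le> R * CARD('n)"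
      by (meson mult_left_mono order_trans)
  qed
  show "(*v) A ` cbox (\<chi> i. - (1 / 2)) (\<chi> i. 1 / 2) \<in> sets lborel"
    by (simp, rule borel_compact, rule compact_continuous_image) (auto intro!: continuous_intros compact_cbox)
  show "cball (0::real^'n) (R * CARD('n)) \<in> fmeasurable lborel"
    using emeasure_bounded_finite[OF bounded_cball, of "0::real^'n" "R * CARD('n)"] by (intro fmeasurableI) simp_all
qed

text \<open>
  The measure \<open>S \<mapsto> lborel(A S)\<close> is invariant under translations because \<open>A\<close> is linear, hence it is
  a multiple of Lebesgue measure, and the unit cube shows which multiple.
\<close>

lemma lborel_linear_affine:
  fixes A :: "real^'n^'n" and t :: "real^'n"
  assumes "invertible A"
  shows "lborel = density (distr lborel borel (\<lambda>x. t + A *v x)) (\<lambda>_. ennreal (vol_scale A))"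
proof -
  let ?B = "matrix_inv A" and ?Q = "cbox (\<chi> i. - (1 / 2)) (\<chi> i. 1 / 2) :: (real^'n) set"
  let ?M = "distr lborel borel ((*v) ?B)"
  note inv = matrix_inv_vector[OF assms]
  have comp: "compact ((*v) C ` K)" if "compact K" for C :: "real^'n^'n" and K
    using that by (intro compact_continuous_image) (auto intro!: continuous_intros)
  have im: "(*v) ?B -` S = (*v) A ` S" for S
  proof (intro set_eqI iffI)
    show "x \<in> (*v) A ` S" if "x \<in> (*v) ?B -` S" for x
      using that by (intro image_eqI[of _ _ "?B *v x"]) (simp_all add: inv)
  qed (auto simp: inv)
  have M: "emeasure ?M S = emeasure lborel ((*v) A ` S)" if "S \<in> sets borel" for S
    using that by (subst emeasure_distr) (simp_all add: im)
  have Q: "emeasure ?M ?Q = ennreal (vol_scale A)"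
  proof -
    have "emeasure lborel ((*v) A ` ?Q) < \<infinity>"
      by (rule emeasure_bounded_finite[OF compact_imp_bounded[OF comp[OF compact_cbox]]])
    then have "emeasure lborel ((*v) A ` ?Q) = ennreal (vol_scale A)"
      unfolding vol_scale_def by (intro emeasure_eq_ennreal_measure) auto
    then show ?thesis by (subst M) auto
  qed
  have AS: "emeasure lborel ((*v) A ` S) = ennreal (vol_scale A) * emeasure lborel S" if S: "S \<in> sets borel" for S
  proof -
    have "emeasure ?M S = emeasure ?M ?Q * emeasure lborel S"
    proof (rule translation_invariant_measure_unique[OF _ _ _ _ _ _ S])
      fix x C assume C: "C \<in> sets (borel :: (real^'n) measure)"
      have C': "(\<lambda>y. y + x) -` C \<in> sets borel"
        by (rule measurable_sets_borel[OF _ C]) simp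
      have AC: "(*v) A ` C \<in> sets borel"
        using measurable_sets_borel[of "(*v) ?B" borel C] C by (simp add: im)
      have "emeasure ?M ((\<lambda>y. y + x) -` C) = emeasure lborel ((*v) A ` ((\<lambda>y. y + x) -` C))"
        by (rule M[OF C'])
      also have "(*v) A ` ((\<lambda>y. y + x) -` C) = (+) (A *v x) -` ((*v) A ` C)"
      proof (intro set_eqI iffI)
        fix z assume "z \<in> (+) (A *v x) -` ((*v) A ` C)"
        then obtain c where c: "c \<in> C" "A *v x + z = A *v c" by auto
        then have "z = A *v (c - x)" by (simp add: matrix_vector_mult_diff_distrib algebra_simps)
        then show "z \<in> (*v) A ` ((\<lambda>y. y + x) -` C)" using c by auto
      qed (auto simp: matrix_vector_right_distrib[symmetric] add.commute)
      also have "emeasure lborel \<dots> = emeasure (distr lborel borel ((+) (A *v x))) ((*v) A ` C)"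
        using AC by (subst emeasure_distr) simp_all
      also have "\<dots> = emeasure lborel ((*v) A ` C)" by (simp add: lborel_distr_plus)
      finally show "emeasure ?M ((\<lambda>y. y + x) -` C) = emeasure ?M C" using C by (simp add: M)
    next
      fix K :: "(real^'n) set" assume K: "compact K"
      show "emeasure ?M K < \<infinity>"
        using emeasure_bounded_finite[OF compact_imp_bounded[OF comp[OF K]], of A]
        by (subst M) (simp_all add: borel_compact K)
    next
      show "uminus ` ?Q = ?Q"
      proof (intro set_eqI iffI)
        show "x \<in> uminus ` ?Q" if "x \<in> ?Q" for x
          using that by (intro image_eqI[of _ _ "- x"]) (auto simp: mem_box_cart minus_le_iff le_minus_iff)
      qed (auto simp: mem_box_cart minus_le_iff le_minus_iff)
      show "emeasure lborel ?Q = 1"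
      proof -
        have "emeasure lborel ?Q = ennreal (measure lborel ?Q)"
          using emeasure_bounded_finite[OF bounded_cbox, of "\<chi> i. - (1 / 2)" "(\<chi> i. 1 / 2) :: real^'n"]
          by (intro emeasure_eq_ennreal_measure) auto
        also have "measure lborel ?Q = 1" by (subst content_cbox_cart) (auto simp: interval_ne_empty_cart)
        finally show ?thesis by simp
      qed
    qed simp_all
    then show ?thesis using S by (simp add: M Q)
  qed
  show ?thesis
  proof (rule measure_eqI)
    fix S assume "S \<in> sets (lborel :: (real^'n) measure)"
    then have S: "S \<in> sets borel" by simp
    have [measurable]: "(\<lambda>x. t + A *v x) \<in> borel_measurable borel" by measurable
    let ?T = "(\<lambda>x. t + A *v x) -` S"
    have T: "?T \<in> sets borel" by (rule measurable_sets_borel[OF _ S]) simp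
    have "(*v) A ` ?T = (+) t -` S"
    proof (intro set_eqI iffI)
      show "x \<in> (*v) A ` ?T" if "x \<in> (+) t -` S" for x
        using that by (intro image_eqI[of _ _ "?B *v x"]) (simp_all add: inv)
    qed auto
    then have "ennreal (vol_scale A) * emeasure lborel ?T = emeasure lborel ((+) t -` S)"
      using AS[OF T] by simp
    also have "\<dots> = emeasure (distr lborel borel ((+) t)) S"
      using S by (subst emeasure_distr) simp_all
    finally show "emeasure lborel S = emeasure (density (distr lborel borel (\<lambda>x. t + A *v x)) (\<lambda>_. ennreal (vol_scale A))) S"
      using S by (simp add: lborel_distr_plus emeasure_density nn_integral_cmult emeasure_distr)
  qed simp
qed

lemma vol_scale_pos:
  fixes A :: "real^'n^'n"
  assumes "invertible A"
  shows "0 < vol_scale A"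
proof -
  have "vol_scale A \<noteq> 0"
  proof
    assume "vol_scale A = 0"
    then have "lborel = density (distr lborel borel (\<lambda>x. 0 + A *v x)) (\<lambda>_. ennreal 0)"
      using lborel_linear_affine[OF assms, of 0] by simp
    then have "emeasure lborel (UNIV::(real^'n) set) = emeasure (density (distr lborel borel (\<lambda>x. 0 + A *v x)) (\<lambda>_. ennreal 0)) UNIV"
      by (rule arg_cong)
    then show False by (simp add: emeasure_density)
  qed
  then show ?thesis by (simp add: vol_scale_def order_less_le)
qed

lemma nn_integral_linear_affine:
  fixes A :: "real^'n^'n" and t :: "real^'n"
  assumes "invertible A" and [measurable]: "f \<in> borel_measurable borel"
  shows "(\<integral>\<^sup>+x. f x \<partial>lborel) = ennreal (vol_scale A) * (\<integral>\<^sup>+x. f (t + A *v x) \<partial>lborel)"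
  by (subst lborel_linear_affine[OF assms(1), of t])
    (simp add: nn_integral_density nn_integral_distr nn_integral_cmult)

lemma integrable_linear_affine:
  fixes f :: "real^'n \<Rightarrow> 'b::{banach, second_countable_topology}" and A :: "real^'n^'n"
  assumes A: "invertible A" and f: "integrable lborel f"
  shows "integrable lborel (\<lambda>x. f (t + A *v x))"
  using f f[THEN borel_measurable_integrable] A unfolding integrable_iff_bounded
  by (subst (asm) nn_integral_linear_affine[where A=A and t=t]) (auto simp: ennreal_mult_less_top ennreal_eq_0_iff dest: vol_scale_pos)

lemma integral_linear_affine:
  fixes f :: "real^'n \<Rightarrow> 'b::{banach, second_countable_topology}" and A :: "real^'n^'n"
  assumes A: "invertible A" and f: "integrable lborel f"
  shows "(\<integral>x. f x \<partial>lborel) = (vol_scale A) *\<^sub>R (\<integral>x. f (t + A *v x) \<partial>lborel)"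
proof -
  have [measurable]: "f \<in> borel_measurable borel" using f by (simp add: borel_measurable_integrable)
  show ?thesis
    using integrable_linear_affine[OF A f, of t] less_imp_le[OF vol_scale_pos[OF A]]
    by (subst lborel_linear_affine[OF A, of t])
      (simp add: integral_density integral_distr)
qed

section \<open>Inversion and injectivity of the Fourier transform\<close>

lemma borel_measurable_cis[measurable (raw)]:
  assumes "f \<in> borel_measurable M"
  shows "(\<lambda>x. cis (f x)) \<in> borel_measurable M"
  by (rule borel_measurable_continuous_on[OF _ assms]) (intro continuous_intros)

lemma fourier_cis: "fourier f \<xi> = (LINT x|lborel. f x * cis (- (2 * pi * (x \<bullet> \<xi>))))"
  unfolding fourier_def by (simp add: cis_conv_exp mult_ac)

definition inv_fourier :: "(real^'n \<Rightarrow> complex) \<Rightarrow> (real^'n \<Rightarrow> complex)" where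
  "inv_fourier f x = (LINT \<xi>|lborel. f \<xi> * cis (2 * pi * (x \<bullet> \<xi>)))"

lemma borel_measurable_inv_fourier[measurable]:
  assumes [measurable]: "f \<in> borel_measurable borel"
  shows "inv_fourier f \<in> borel_measurable borel"
  unfolding inv_fourier_def[abs_def] by measurable

lemma norm_inv_fourier_le: "norm (inv_fourier f x) \<le> (LINT \<xi>|lborel. norm (f \<xi>))"
  unfolding inv_fourier_def by (rule integral_norm_bound[THEN order_trans]) (simp add: norm_mult)

lemma integrable_mult_cis:
  fixes f :: "real^'n \<Rightarrow> complex"
  assumes f: "integrable lborel f" and [measurable]: "g \<in> borel_measurable borel"
  shows "integrable lborel (\<lambda>x. f x * cis (g x))"
proof (rule Bochner_Integration.integrable_bound[OF f])
  show "(\<lambda>x. f x * cis (g x)) \<in> borel_measurable lborel"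
    using borel_measurable_integrable[OF f] by measurable
qed (simp add: norm_mult)

lemma integral_scaling:
  fixes f :: "'a::euclidean_space \<Rightarrow> 'b::{banach, second_countable_topology}"
  assumes c: "c \<noteq> 0" and f: "integrable lborel f"
  shows "integrable lborel (\<lambda>x. f (t + c *\<^sub>R x))"
    and "(LINT x|lborel. f x) = \<bar>c\<bar> ^ DIM('a) *\<^sub>R (LINT x|lborel. f (t + c *\<^sub>R x))"
proof -
  have [measurable]: "f \<in> borel_measurable borel" using f by (simp add: borel_measurable_integrable)
  have "integrable (density (distr lborel borel (\<lambda>x. t + c *\<^sub>R x)) (\<lambda>_. ennreal (\<bar>c\<bar> ^ DIM('a)))) f"
    using f by (subst lborel_affine[OF c, of t, symmetric])
  then have "integrable lborel (\<lambda>x. \<bar>c\<bar> ^ DIM('a) *\<^sub>R f (t + c *\<^sub>R x))"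
    by (simp add: integrable_density integrable_distr_eq)
  then have "integrable lborel (\<lambda>x. (1 / \<bar>c\<bar> ^ DIM('a)) *\<^sub>R (\<bar>c\<bar> ^ DIM('a) *\<^sub>R f (t + c *\<^sub>R x)))"
    by (rule integrable_scaleR_right)
  then show 1: "integrable lborel (\<lambda>x. f (t + c *\<^sub>R x))" using c by simp
  show "(LINT x|lborel. f x) = \<bar>c\<bar> ^ DIM('a) *\<^sub>R (LINT x|lborel. f (t + c *\<^sub>R x))"
    by (subst lborel_affine[OF c, of t]) (simp add: integral_density integral_distr)
qed

text \<open>
  Lebesgue measure is the image of a product measure under the coordinate map, so Fubini's theorem
  for finite products applies.
\<close>

lemma integral_lborel_prod:
  fixes f :: "'a::euclidean_space \<Rightarrow> real \<Rightarrow> 'b::{real_normed_field,banach,second_countable_topology}"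
  assumes f: "\<And>b. b \<in> Basis \<Longrightarrow> integrable lborel (f b)"
  shows "integrable lborel (\<lambda>x::'a. \<Prod>b\<in>Basis. f b (x \<bullet> b))"
    and "(LINT x|lborel. (\<Prod>b\<in>(Basis::'a set). f b (x \<bullet> b))) = (\<Prod>b\<in>Basis. (LINT t|lborel. f b t))"
proof -
  interpret P: product_sigma_finite "\<lambda>_::'a. lborel :: real measure"
    by standard
  let ?T = "\<lambda>g. \<Sum>b\<in>Basis. g b *\<^sub>R b :: 'a"
  have L: "lborel = distr (\<Pi>\<^sub>M b\<in>Basis. lborel) borel ?T"
    using lborel_eq[where 'a='a] by simp
  have fm[measurable]: "\<And>b. b \<in> Basis \<Longrightarrow> f b \<in> borel_measurable borel"
    using f by (simp add: borel_measurable_integrable)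
  have T: "?T g \<bullet> b = g b" if "b \<in> Basis" for g b
    using that by simp
  have pf: "(\<Prod>b\<in>Basis. f b (?T g \<bullet> b)) = (\<Prod>b\<in>Basis. f b (g b))" for g
    by (rule prod.cong) (simp_all add: T)
  have "integrable (\<Pi>\<^sub>M b\<in>Basis. lborel) (\<lambda>g. \<Prod>b\<in>Basis. f b (?T g \<bullet> b))"
    unfolding pf by (rule P.product_integrable_prod[OF finite_Basis f])
  then show "integrable lborel (\<lambda>x::'a. \<Prod>b\<in>Basis. f b (x \<bullet> b))"
    by (subst L, subst integrable_distr_eq) simp_all
  show "(LINT x|lborel. (\<Prod>b\<in>(Basis::'a set). f b (x \<bullet> b))) = (\<Prod>b\<in>Basis. (LINT t|lborel. f b t))"
    by (subst L, subst integral_distr) (simp_all only: pf P.product_integral_prod[OF finite_Basis f], simp_all)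
qed

text \<open>
  This is the characteristic function of the standard normal distribution, rescaled so that the
  Gaussian becomes its own Fourier transform.
\<close>

lemma gauss_fourier_1d:
  shows "integrable lborel (\<lambda>x::real. complex_of_real (exp (- pi * x\<^sup>2)) * cis (2 * pi * (x * t)))"
    and "(LINT x|lborel. complex_of_real (exp (- pi * x\<^sup>2)) * cis (2 * pi * (x * t))) = of_real (exp (- pi * t\<^sup>2))"
proof -
  let ?r = "sqrt (2 * pi)"
  let ?f = "\<lambda>x. std_normal_density x *\<^sub>R iexp (?r * t * x)"
  have r: "?r \<noteq> 0" "?r > 0" "?r * ?r = 2 * pi" by simp_all
  have f: "integrable lborel ?f"
    by (rule Bochner_Integration.integrable_bound[of _ std_normal_density]) simp_all
  have sc: "?f (0 + ?r * x) = (1 / ?r) *\<^sub>R (complex_of_real (exp (- pi * x\<^sup>2)) * cis (2 * pi * (x * t)))" for x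
  proof -
    have "std_normal_density (?r * x) = (1 / ?r) * exp (- pi * x\<^sup>2)"
      unfolding std_normal_density_def by (simp add: power_mult_distrib)
    moreover have "iexp (?r * t * (?r * x)) = cis (2 * pi * (x * t))"
    proof -
      have "?r * t * (?r * x) = 2 * pi * (x * t)" using r(3) by algebra
      then show ?thesis by (simp only: cis_conv_exp)
    qed
    ultimately show ?thesis by (simp add: scaleR_conv_of_real)
  qed
  have "integrable lborel (\<lambda>x. ?f (0 + ?r * x))"
    by (rule lborel_integrable_real_affine[OF f r(1)])
  then have "integrable lborel (\<lambda>x. ?r *\<^sub>R ?f (0 + ?r * x))"
    by (rule integrable_scaleR_right)
  then show "integrable lborel (\<lambda>x::real. complex_of_real (exp (- pi * x\<^sup>2)) * cis (2 * pi * (x * t)))"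
    unfolding sc using r by simp
  have "of_real (exp (- pi * t\<^sup>2)) = char std_normal_distribution (?r * t)"
    by (simp add: char_std_normal_distribution power_mult_distrib)
  also have "\<dots> = (LINT x|lborel. ?f x)"
    unfolding char_def by (subst integral_density) simp_all
  also have "\<dots> = \<bar>?r\<bar> *\<^sub>R (LINT x|lborel. ?f (0 + ?r * x))"
    by (rule lborel_integral_real_affine[OF r(1)])
  also have "\<dots> = (LINT x|lborel. complex_of_real (exp (- pi * x\<^sup>2)) * cis (2 * pi * (x * t)))"
    unfolding sc using r by simp
  finally show "(LINT x|lborel. complex_of_real (exp (- pi * x\<^sup>2)) * cis (2 * pi * (x * t))) = of_real (exp (- pi * t\<^sup>2))" ..
qed

text \<open>
  Normalized so that it is its own Fourier transform.
\<close>

definition gauss :: "'a::euclidean_space \<Rightarrow> real" where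
  "gauss x = exp (- pi * (norm x)\<^sup>2)"

lemma gauss_pos: "0 < gauss x" by (simp add: gauss_def)
lemma gauss_le_1: "gauss x \<le> 1" by (simp add: gauss_def)
lemma continuous_gauss: "continuous_on UNIV gauss" unfolding gauss_def by (intro continuous_intros)
lemma borel_measurable_gauss[measurable]: "gauss \<in> borel_measurable borel"
  by (rule borel_measurable_continuous_onI[OF continuous_gauss])

lemma gauss_fourier:
  fixes \<xi> :: "'a::euclidean_space"
  shows "(LINT x|lborel. complex_of_real (gauss x) * cis (2 * pi * (x \<bullet> \<xi>))) = of_real (gauss \<xi>)"
    and "integrable lborel (gauss :: 'a \<Rightarrow> real)"
proof -
  let ?f = "\<lambda>\<xi> b (s::real). complex_of_real (exp (- pi * s\<^sup>2)) * cis (2 * pi * (s * (\<xi> \<bullet> b)))"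
  have g: "gauss x = (\<Prod>b\<in>Basis. exp (- pi * (x \<bullet> b)\<^sup>2))" for x :: 'a
  proof -
    have "(norm x)\<^sup>2 = (\<Sum>b\<in>Basis. (x \<bullet> b)\<^sup>2)"
      by (subst euclidean_inner[of x x, unfolded power2_norm_eq_inner[symmetric] power2_eq_square[symmetric]]) simp
    then show ?thesis
      by (simp add: gauss_def exp_sum[symmetric] sum_distrib_left sum_negf)
  qed
  have cprod: "cis (\<Sum>b\<in>B. h b) = (\<Prod>b\<in>B. cis (h b))" if "finite B" for h and B :: "'a set"
    using that by induction (simp_all add: cis_mult[symmetric])
  have e: "complex_of_real (gauss x) * cis (2 * pi * (x \<bullet> \<xi>)) = (\<Prod>b\<in>Basis. ?f \<xi> b (x \<bullet> b))" for x \<xi> :: 'a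
    by (simp add: g prod.distrib euclidean_inner[of x \<xi>] sum_distrib_left cprod)
  show "(LINT x|lborel. complex_of_real (gauss x) * cis (2 * pi * (x \<bullet> \<xi>))) = of_real (gauss \<xi>)"
    unfolding e by (subst integral_lborel_prod) (simp_all add: gauss_fourier_1d[unfolded mult_minus_left] g)
  have "integrable lborel (\<lambda>x::'a. complex_of_real (gauss x) * cis (2 * pi * (x \<bullet> 0)))"
    unfolding e by (rule integral_lborel_prod(1)) (rule gauss_fourier_1d(1))
  then show "integrable lborel (gauss :: 'a \<Rightarrow> real)"
    by (simp add: complex_of_real_integrable_eq)
qed

lemma integral_gauss: "(LINT x|lborel. gauss (x::'a::euclidean_space)) = 1"
proof -
  have "complex_of_real (LINT x|lborel. gauss (x::'a)) = 1"
    using gauss_fourier(1)[of "0::'a"] by (simp add: gauss_def)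
  then show ?thesis by simp
qed

lemma integrable_tensor_bound:
  fixes h :: "'a::euclidean_space \<times> 'b::euclidean_space \<Rightarrow> complex"
    and f :: "'a \<Rightarrow> complex" and g :: "'b \<Rightarrow> real"
  assumes h: "h \<in> borel_measurable (lborel \<Otimes>\<^sub>M lborel)"
    and f: "integrable lborel f" and g: "integrable lborel g"
    and le: "\<And>x y. norm (h (x, y)) \<le> norm (f x) * norm (g y)"
  shows "integrable (lborel \<Otimes>\<^sub>M lborel) h"
proof (rule Bochner_Integration.integrable_bound[OF _ h])
  have [measurable]: "f \<in> borel_measurable borel" "g \<in> borel_measurable borel"
    using f g by (simp_all add: borel_measurable_integrable)
  show "integrable (lborel \<Otimes>\<^sub>M lborel) (\<lambda>(x, y). norm (f x) * norm (g y))"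
  proof (rule lborel_pair.Fubini_integrable)
    show "integrable lborel (\<lambda>x. LINT y|lborel. norm (case (x, y) of (x, y) \<Rightarrow> norm (f x) * norm (g y)))"
      using integrable_norm[OF f] by simp
    show "AE x in lborel. integrable lborel (\<lambda>y. case (x, y) of (x, y) \<Rightarrow> norm (f x) * norm (g y))"
      using g by (simp add: integrable_norm)
  qed measurable
  show "AE x in lborel \<Otimes>\<^sub>M lborel. norm (h x) \<le> norm (case x of (x, y) \<Rightarrow> norm (f x) * norm (g y))"
    using le by auto
qed

text \<open>
  Insert the definition of \<open>inv_fourier \<phi>\<close> and exchange the integrals: the Gaussian factor makes
  the double integral absolutely convergent. The inner integral is then the transform of a dilated
  Gaussian, which is again a Gaussian, centred at \<open>\<xi>\<close> and of width \<open>\<epsilon>\<close>.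
\<close>

lemma inv_fourier_gauss_mean:
  fixes \<phi> :: "real^'n \<Rightarrow> complex"
  assumes \<phi>: "integrable lborel \<phi>" and \<epsilon>: "0 < \<epsilon>"
  shows "fourier (\<lambda>x. inv_fourier \<phi> x * of_real (gauss (\<epsilon> *\<^sub>R x))) \<xi>
    = (LINT z|lborel. \<phi> (\<xi> + \<epsilon> *\<^sub>R z) * of_real (gauss z))"
proof -
  have [measurable]: "\<phi> \<in> borel_measurable borel" using \<phi> by (simp add: borel_measurable_integrable)
  let ?F = "\<lambda>x \<eta>. \<phi> \<eta> * cis (2 * pi * (x \<bullet> (\<eta> - \<xi>))) * complex_of_real (gauss (\<epsilon> *\<^sub>R x))"
  let ?D = "\<epsilon> ^ CARD('n)"
  have ge: "integrable lborel (\<lambda>x::real^'n. gauss (\<epsilon> *\<^sub>R x))"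
    using integral_scaling(1)[OF _ gauss_fourier(2), of \<epsilon> 0] \<epsilon> by simp
  have F: "integrable (lborel \<Otimes>\<^sub>M lborel) (case_prod ?F)"
    by (rule integrable_tensor_bound[where f="\<lambda>x. complex_of_real (gauss (\<epsilon> *\<^sub>R x))" and g="\<lambda>\<eta>. norm (\<phi> \<eta>)"])
      (use \<phi> ge in \<open>simp_all add: norm_mult gauss_pos less_imp_le\<close>)
  have "fourier (\<lambda>x. inv_fourier \<phi> x * of_real (gauss (\<epsilon> *\<^sub>R x))) \<xi> = (LINT x|lborel. (LINT \<eta>|lborel. ?F x \<eta>))"
    unfolding fourier_cis
  proof (rule Bochner_Integration.integral_cong[OF refl])
    fix x :: "real^'n"
    have c: "cis (2 * pi * (x \<bullet> (\<eta> - \<xi>))) = cis (2 * pi * (x \<bullet> \<eta>)) * cis (- (2 * pi * (x \<bullet> \<xi>)))" for \<eta>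
      by (simp add: cis_mult inner_diff_right right_diff_distrib)
    have "(LINT \<eta>|lborel. ?F x \<eta>) = (LINT \<eta>|lborel. \<phi> \<eta> * cis (2 * pi * (x \<bullet> \<eta>)) * (cis (- (2 * pi * (x \<bullet> \<xi>))) * complex_of_real (gauss (\<epsilon> *\<^sub>R x))))"
      unfolding c by (simp only: mult.assoc)
    also have "\<dots> = inv_fourier \<phi> x * (cis (- (2 * pi * (x \<bullet> \<xi>))) * complex_of_real (gauss (\<epsilon> *\<^sub>R x)))"
      unfolding inv_fourier_def by (rule integral_mult_left_zero)
    finally show "inv_fourier \<phi> x * of_real (gauss (\<epsilon> *\<^sub>R x)) * cis (- (2 * pi * (x \<bullet> \<xi>))) = (LINT \<eta>|lborel. ?F x \<eta>)"
      by (simp only: mult_ac)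
  qed
  also have "\<dots> = (LINT \<eta>|lborel. (LINT x|lborel. ?F x \<eta>))"
    by (rule lborel_pair.Fubini_integral[OF F, symmetric])
  also have "\<dots> = (LINT \<eta>|lborel. (1 / ?D) *\<^sub>R (\<phi> \<eta> * of_real (gauss ((1 / \<epsilon>) *\<^sub>R (\<eta> - \<xi>)))))"
  proof (rule Bochner_Integration.integral_cong[OF refl])
    fix \<eta>
    let ?q = "(1 / \<epsilon>) *\<^sub>R (\<eta> - \<xi>)"
    have i: "integrable lborel (\<lambda>x. complex_of_real (gauss x) * cis (2 * pi * (x \<bullet> ?q)))"
      by (rule integrable_mult_cis) (simp_all add: gauss_fourier(2))
    have "(LINT x|lborel. ?F x \<eta>) = \<phi> \<eta> * (LINT x|lborel. complex_of_real (gauss (0 + \<epsilon> *\<^sub>R x)) * cis (2 * pi * ((0 + \<epsilon> *\<^sub>R x) \<bullet> ?q)))"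
      unfolding integral_mult_right_zero[symmetric]
      by (rule Bochner_Integration.integral_cong[OF refl]) (use \<epsilon> in \<open>simp add: mult_ac\<close>)
    moreover have "of_real (gauss ?q) = ?D *\<^sub>R (LINT x|lborel. complex_of_real (gauss (0 + \<epsilon> *\<^sub>R x)) * cis (2 * pi * ((0 + \<epsilon> *\<^sub>R x) \<bullet> ?q)))"
      unfolding gauss_fourier(1)[of ?q, symmetric]
      using integral_scaling(2)[OF _ i, of \<epsilon> 0] \<epsilon> by simp
    ultimately show "(LINT x|lborel. ?F x \<eta>) = (1 / ?D) *\<^sub>R (\<phi> \<eta> * of_real (gauss ?q))"
      using \<epsilon> by (simp add: scaleR_conv_of_real)
  qed
  also have "\<dots> = (1 / ?D) *\<^sub>R (LINT \<eta>|lborel. \<phi> \<eta> * of_real (gauss ((1 / \<epsilon>) *\<^sub>R (\<eta> - \<xi>))))"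
    by simp
  also have "(LINT \<eta>|lborel. \<phi> \<eta> * of_real (gauss ((1 / \<epsilon>) *\<^sub>R (\<eta> - \<xi>))))
     = ?D *\<^sub>R (LINT z|lborel. \<phi> (\<xi> + \<epsilon> *\<^sub>R z) * of_real (gauss z))"
  proof -
    have i: "integrable lborel (\<lambda>\<eta>. \<phi> \<eta> * complex_of_real (gauss ((1 / \<epsilon>) *\<^sub>R (\<eta> - \<xi>))))"
      by (rule Bochner_Integration.integrable_bound[OF \<phi>])
        (simp_all add: norm_mult gauss_pos less_imp_le gauss_le_1 mult_left_le)
    show ?thesis
      using integral_scaling(2)[OF _ i, of \<epsilon> \<xi>] \<epsilon> by simp
  qed
  finally show ?thesis using \<epsilon> by simp
qed

text \<open>
  Gaussian averages of decreasing width recover a bounded continuous function pointwise, and stay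
  below its bound, which is what later applications of dominated convergence ask for.
\<close>

lemma gauss_mean_tendsto:
  fixes \<phi> :: "real^'n \<Rightarrow> complex"
  assumes c: "continuous_on UNIV \<phi>" and B: "\<And>x. norm (\<phi> x) \<le> B"
  shows "(\<lambda>n. LINT z|lborel. \<phi> (\<xi> + inverse (real (Suc n)) *\<^sub>R z) * of_real (gauss z)) \<longlonglongrightarrow> \<phi> \<xi>"
    and "norm (LINT z|lborel. \<phi> (\<xi> + e *\<^sub>R z) * of_real (gauss z)) \<le> B"
proof -
  have [measurable]: "\<phi> \<in> borel_measurable borel" by (rule borel_measurable_continuous_onI[OF c])
  have B0: "0 \<le> B" using B[of 0] norm_ge_zero order_trans by blast
  have "(\<lambda>n. LINT z|lborel. \<phi> (\<xi> + inverse (real (Suc n)) *\<^sub>R z) * of_real (gauss z)) \<longlonglongrightarrow>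
     (LINT z|lborel. \<phi> \<xi> * of_real (gauss (z::real^'n)))"
  proof (rule integral_dominated_convergence[where w="\<lambda>z. B * gauss z"])
    show "AE z in lborel. (\<lambda>n. \<phi> (\<xi> + inverse (real (Suc n)) *\<^sub>R z) * complex_of_real (gauss z)) \<longlonglongrightarrow> \<phi> \<xi> * complex_of_real (gauss z)"
    proof (rule AE_I2)
      fix z :: "real^'n"
      have "(\<lambda>n. \<xi> + inverse (real (Suc n)) *\<^sub>R z) \<longlonglongrightarrow> \<xi> + 0 *\<^sub>R z"
        by (intro tendsto_intros LIMSEQ_inverse_real_of_nat)
      then have "(\<lambda>n. \<phi> (\<xi> + inverse (real (Suc n)) *\<^sub>R z)) \<longlonglongrightarrow> \<phi> \<xi>"
        using c by (auto simp: continuous_on_eq_continuous_at intro: isCont_tendsto_compose)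
      then show "(\<lambda>n. \<phi> (\<xi> + inverse (real (Suc n)) *\<^sub>R z) * complex_of_real (gauss z)) \<longlonglongrightarrow> \<phi> \<xi> * complex_of_real (gauss z)"
        by (rule tendsto_mult_right)
    qed
  qed (simp_all add: gauss_fourier(2) norm_mult B gauss_pos less_imp_le mult_right_mono)
  then show "(\<lambda>n. LINT z|lborel. \<phi> (\<xi> + inverse (real (Suc n)) *\<^sub>R z) * of_real (gauss z)) \<longlonglongrightarrow> \<phi> \<xi>"
    by (simp add: integral_gauss)
  have "norm (LINT z|lborel. \<phi> (\<xi> + e *\<^sub>R z) * of_real (gauss z)) \<le> (LINT z|lborel. norm (\<phi> (\<xi> + e *\<^sub>R z) * of_real (gauss z)))"
    by (rule integral_norm_bound)
  also have "\<dots> \<le> (LINT z|lborel. B * gauss (z::real^'n))"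
    by (rule integral_mono')
      (simp_all add: gauss_fourier(2) norm_mult B gauss_pos less_imp_le mult_right_mono B0)
  finally show "norm (LINT z|lborel. \<phi> (\<xi> + e *\<^sub>R z) * of_real (gauss z)) \<le> B"
    by (simp add: integral_gauss)
qed

text \<open>
  Let the width of the Gaussian tend to \<open>0\<close> in the identity for the damped inversion integral.
\<close>

theorem fourier_inv_fourier:
  fixes \<phi> :: "real^'n \<Rightarrow> complex"
  assumes \<phi>: "integrable lborel \<phi>" and c: "continuous_on UNIV \<phi>" and B: "\<And>x. norm (\<phi> x) \<le> B"
    and i: "integrable lborel (inv_fourier \<phi>)"
  shows "fourier (inv_fourier \<phi>) = \<phi>"
proof
  fix \<xi>
  let ?e = "\<lambda>n. inverse (real (Suc n))"
  have [measurable]: "\<phi> \<in> borel_measurable borel" by (rule borel_measurable_continuous_onI[OF c])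
  have "(\<lambda>n. fourier (\<lambda>x. inv_fourier \<phi> x * of_real (gauss (?e n *\<^sub>R x))) \<xi>) \<longlonglongrightarrow> fourier (inv_fourier \<phi>) \<xi>"
    unfolding fourier_cis
  proof (rule integral_dominated_convergence[where w="\<lambda>x. norm (inv_fourier \<phi> x)"])
    show "AE x in lborel. (\<lambda>n. inv_fourier \<phi> x * complex_of_real (gauss (?e n *\<^sub>R x)) * cis (- (2 * pi * (x \<bullet> \<xi>))))
        \<longlonglongrightarrow> inv_fourier \<phi> x * cis (- (2 * pi * (x \<bullet> \<xi>)))"
    proof (rule AE_I2)
      fix x :: "real^'n"
      have "(\<lambda>n. ?e n *\<^sub>R x) \<longlonglongrightarrow> 0 *\<^sub>R x"
        by (intro tendsto_intros LIMSEQ_inverse_real_of_nat)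
      then have "(\<lambda>n. gauss (?e n *\<^sub>R x)) \<longlonglongrightarrow> gauss (0 *\<^sub>R x)"
        using continuous_gauss by (auto simp: continuous_on_eq_continuous_at intro: isCont_tendsto_compose)
      then have "(\<lambda>n. inv_fourier \<phi> x * complex_of_real (gauss (?e n *\<^sub>R x)) * cis (- (2 * pi * (x \<bullet> \<xi>))))
        \<longlonglongrightarrow> inv_fourier \<phi> x * complex_of_real (gauss (0 *\<^sub>R x)) * cis (- (2 * pi * (x \<bullet> \<xi>)))"
        by (intro tendsto_intros)
      then show "(\<lambda>n. inv_fourier \<phi> x * complex_of_real (gauss (?e n *\<^sub>R x)) * cis (- (2 * pi * (x \<bullet> \<xi>))))
        \<longlonglongrightarrow> inv_fourier \<phi> x * cis (- (2 * pi * (x \<bullet> \<xi>)))"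
        by (simp add: gauss_def)
    qed
  qed (use i in \<open>simp_all add: integrable_norm norm_mult gauss_pos gauss_le_1 less_imp_le mult_left_le\<close>)
  moreover have "(\<lambda>n. fourier (\<lambda>x. inv_fourier \<phi> x * of_real (gauss (?e n *\<^sub>R x))) \<xi>) \<longlonglongrightarrow> \<phi> \<xi>"
    using gauss_mean_tendsto(1)[OF c B] by (simp add: inv_fourier_gauss_mean[OF \<phi>])
  ultimately show "fourier (inv_fourier \<phi>) \<xi> = \<phi> \<xi>" by (rule LIMSEQ_unique)
qed

lemma fourier_multiplication_formula:
  fixes u k :: "real^'n \<Rightarrow> complex"
  assumes u: "integrable lborel u" and k: "integrable lborel k"
  shows "(LINT x|lborel. fourier u x * k x) = (LINT y|lborel. u y * fourier k y)"
proof -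
  have [measurable]: "u \<in> borel_measurable borel" "k \<in> borel_measurable borel"
    using u k by (simp_all add: borel_measurable_integrable)
  let ?F = "\<lambda>x y. u y * k x * cis (- (2 * pi * (x \<bullet> y)))"
  have F: "integrable (lborel \<Otimes>\<^sub>M lborel) (case_prod ?F)"
    by (rule integrable_tensor_bound[where f=k and g="\<lambda>y. norm (u y)"])
      (use u k in \<open>simp_all add: norm_mult\<close>)
  have "(LINT x|lborel. fourier u x * k x) = (LINT x|lborel. (LINT y|lborel. ?F x y))"
    unfolding fourier_cis by (subst integral_mult_left_zero[symmetric]) (simp add: mult_ac inner_commute)
  also have "\<dots> = (LINT y|lborel. (LINT x|lborel. ?F x y))"
    by (rule lborel_pair.Fubini_integral[OF F, symmetric])
  also have "\<dots> = (LINT y|lborel. u y * fourier k y)"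
    unfolding fourier_cis by (subst integral_mult_right_zero[symmetric]) (simp add: mult_ac)
  finally show ?thesis .
qed

text \<open>
  Test \<open>u\<close> against \<open>fourier k\<close> for \<open>k\<close> the damped inverse transform of \<open>f\<close>. The multiplication
  formula moves the transform onto \<open>u\<close>, where it vanishes, while \<open>fourier k\<close> is a Gaussian average
  of \<open>f\<close> and so tends to \<open>f\<close>.
\<close>

lemma integral_mult_continuous_eq_0:
  fixes u f :: "real^'n \<Rightarrow> complex"
  assumes u: "integrable lborel u" and u0: "\<And>\<xi>. fourier u \<xi> = 0"
    and f: "integrable lborel f" and c: "continuous_on UNIV f" and B: "\<And>x. norm (f x) \<le> B"
  shows "(LINT y|lborel. u y * f y) = 0"
proof -
  let ?e = "\<lambda>n. inverse (real (Suc n))"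
  let ?m = "\<lambda>n y. LINT z|lborel. f (y + ?e n *\<^sub>R z) * complex_of_real (gauss z)"
  have [measurable]: "u \<in> borel_measurable borel" "f \<in> borel_measurable borel"
    using u f by (simp_all add: borel_measurable_integrable)
  have "(LINT y|lborel. u y * ?m n y) = 0" for n
  proof -
    let ?k = "\<lambda>x. inv_fourier f x * complex_of_real (gauss (?e n *\<^sub>R x))"
    have "integrable lborel (\<lambda>x::real^'n. gauss (0 + ?e n *\<^sub>R x))"
      by (rule integral_scaling(1)[OF _ gauss_fourier(2)]) simp
    then have "integrable lborel (\<lambda>x::real^'n. (LINT \<xi>|lborel. norm (f \<xi>)) * gauss (?e n *\<^sub>R x))" by simp
    then have "integrable lborel ?k"
      by (rule Bochner_Integration.integrable_bound)
        (simp_all add: norm_mult gauss_pos less_imp_le mult_right_mono norm_inv_fourier_le)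
    from fourier_multiplication_formula[OF u this] show ?thesis
      by (simp add: u0 inv_fourier_gauss_mean[OF f])
  qed
  moreover have "(\<lambda>n. LINT y|lborel. u y * ?m n y) \<longlonglongrightarrow> (LINT y|lborel. u y * f y)"
  proof (rule integral_dominated_convergence[where w="\<lambda>y. B * norm (u y)"])
    show "AE y in lborel. (\<lambda>n. u y * ?m n y) \<longlonglongrightarrow> u y * f y"
      by (intro AE_I2 tendsto_mult_left gauss_mean_tendsto(1)[OF c B])
    show "AE y in lborel. norm (u y * ?m n y) \<le> B * norm (u y)" for n
    proof (rule AE_I2)
      fix y
      show "norm (u y * ?m n y) \<le> B * norm (u y)"
        using mult_left_mono[OF gauss_mean_tendsto(2)[OF c B, of y "?e n"], of "norm (u y)"]
        by (simp only: norm_mult mult.commute[of B] norm_ge_zero)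
    qed
  qed (use u in \<open>simp_all add: integrable_norm\<close>)
  ultimately show ?thesis by (simp add: LIMSEQ_const_iff)
qed

text \<open>
  The indicator of a closed set is a bounded limit of continuous functions. The Gaussian factor
  makes these functions integrable; its width grows, so it disappears in the limit.
\<close>

lemma set_integral_closed_eq_0:
  fixes u :: "real^'n \<Rightarrow> complex"
  assumes u: "integrable lborel u" and u0: "\<And>\<xi>. fourier u \<xi> = 0" and C: "closed C"
  shows "(LINT y|lborel. indicat_real C y *\<^sub>R u y) = 0"
proof (cases "C = {}")
  case False
  let ?e = "\<lambda>n. inverse (real (Suc n))"
  let ?f = "\<lambda>n x. max 0 (1 - real n * infdist x C) * gauss (?e n *\<^sub>R x)"
  have [measurable]: "u \<in> borel_measurable borel" "C \<in> sets borel"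
    using u C by (simp_all add: borel_measurable_integrable)
  have cont: "continuous_on UNIV (?f n)" for n
    by (intro continuous_intros continuous_on_compose2[OF continuous_gauss]) auto
  then have fm[measurable]: "?f n \<in> borel_measurable borel" for n
    by (rule borel_measurable_continuous_onI)
  have le: "max 0 (1 - real n * infdist x C) \<le> 1" for n x
    by (simp add: infdist_nonneg)
  have bd: "norm (?f n x) \<le> gauss (?e n *\<^sub>R x)" for n x
    using mult_right_mono[OF le[of n x], of "gauss (?e n *\<^sub>R x)"] by (simp add: gauss_pos less_imp_le abs_mult)
  have bd1: "norm (?f n x) \<le> 1" for n x
    using bd gauss_le_1 order_trans by blast
  have "(LINT y|lborel. u y * complex_of_real (?f n y)) = 0" for n
  proof (rule integral_mult_continuous_eq_0[OF u u0, where B=1])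
    have "integrable lborel (\<lambda>x::real^'n. gauss (0 + ?e n *\<^sub>R x))"
      by (rule integral_scaling(1)[OF _ gauss_fourier(2)]) simp
    then have "integrable lborel (?f n)"
      by (rule Bochner_Integration.integrable_bound) (use bd fm in \<open>auto simp: gauss_pos less_imp_le simp del: of_nat_Suc\<close>)
    then show "integrable lborel (\<lambda>y. complex_of_real (?f n y))"
      by (subst complex_of_real_integrable_eq)
    show "continuous_on UNIV (\<lambda>y. complex_of_real (?f n y))"
      by (rule continuous_on_of_real[OF cont])
    show "norm (complex_of_real (?f n x)) \<le> 1" for x
      using bd1[of n x] by (simp only: norm_of_real real_norm_def)
  qed
  moreover have "(\<lambda>n. LINT y|lborel. u y * complex_of_real (?f n y)) \<longlonglongrightarrow> (LINT y|lborel. indicat_real C y *\<^sub>R u y)"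
  proof (rule integral_dominated_convergence[where w="\<lambda>y. norm (u y)"])
    show "AE y in lborel. (\<lambda>n. u y * complex_of_real (?f n y)) \<longlonglongrightarrow> indicat_real C y *\<^sub>R u y"
    proof (rule AE_I2)
      fix y
      have 1: "(\<lambda>n. max 0 (1 - real n * infdist y C)) \<longlonglongrightarrow> indicat_real C y"
      proof (cases "y \<in> C")
        case False
        then have d: "infdist y C > 0" using C \<open>C \<noteq> {}\<close> infdist_pos_not_in_closed by blast
        have "\<forall>\<^sub>F n in sequentially. max 0 (1 - real n * infdist y C) = indicat_real C y"
          using eventually_ge_at_top[of "nat \<lceil>1 / infdist y C\<rceil>"]
        proof eventually_elim
          case (elim n)
          then have "1 / infdist y C \<le> real n" by linarith
          then show ?case using d False by (simp add: divide_le_eq)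
        qed
        then show ?thesis by (rule tendsto_eventually)
      qed simp
      have "(\<lambda>n. ?e n *\<^sub>R y) \<longlonglongrightarrow> 0 *\<^sub>R y"
        by (intro tendsto_intros LIMSEQ_inverse_real_of_nat)
      then have "(\<lambda>n. gauss (?e n *\<^sub>R y)) \<longlonglongrightarrow> gauss (0 *\<^sub>R y)"
        using continuous_gauss by (auto simp: continuous_on_eq_continuous_at intro: isCont_tendsto_compose)
      then have 2: "(\<lambda>n. gauss (?e n *\<^sub>R y)) \<longlonglongrightarrow> 1" by (simp add: gauss_def)
      have "(\<lambda>n. u y * complex_of_real (?f n y)) \<longlonglongrightarrow> u y * complex_of_real (indicat_real C y * 1)"
        by (intro tendsto_intros 1 2)
      then show "(\<lambda>n. u y * complex_of_real (?f n y)) \<longlonglongrightarrow> indicat_real C y *\<^sub>R u y"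
        by (simp add: scaleR_conv_of_real mult.commute)
    qed
    show "AE x in lborel. norm (u x * complex_of_real (?f n x)) \<le> norm (u x)" for n
      using bd1 by (auto simp: norm_mult simp del: of_real_mult intro!: mult_left_le)
    show "(\<lambda>y. u y * complex_of_real (?f n y)) \<in> borel_measurable lborel" for n
      by measurable
  qed (use u in \<open>simp_all add: integrable_norm\<close>)
  ultimately show ?thesis by (simp add: LIMSEQ_const_iff)
qed simp

text \<open>
  Closed sets generate the Borel sets and are stable under intersection, so all integrals of \<open>u\<close>
  over Borel sets vanish.
\<close>

theorem fourier_injective:
  fixes u :: "real^'n \<Rightarrow> complex"
  assumes u: "integrable lborel u" and u0: "\<And>\<xi>. fourier u \<xi> = 0"
  shows "AE x in lborel. u x = 0"
proof (rule sigma_finite_measure.density_zero[OF sigma_finite_lborel u])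
  have [measurable]: "u \<in> borel_measurable borel" using u by (simp add: borel_measurable_integrable)
  have int: "integrable lborel (\<lambda>y. indicat_real A y *\<^sub>R u y)" if "A \<in> sets borel" for A
    using that u by (intro integrable_mult_indicator) auto
  have U: "(LINT y|lborel. u y) = 0"
    using set_integral_closed_eq_0[OF u u0, of UNIV] by simp
  fix A :: "(real^'n) set" assume "A \<in> sets lborel"
  then have A: "A \<in> sigma_sets UNIV (Collect closed)" by (simp add: borel_eq_closed)
  have "Int_stable (Collect closed :: (real^'n) set set)" "Collect closed \<subseteq> Pow (UNIV :: (real^'n) set)"
    by (auto simp: Int_stable_def)
  from this A have "A \<in> sets borel \<and> (LINT y|lborel. indicat_real A y *\<^sub>R u y) = 0"
  proof (induction rule: sigma_sets_induct_disjoint)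
    case (basic C)
    then show ?case using set_integral_closed_eq_0[OF u u0] by auto
  next
    case empty
    then show ?case by simp
  next
    case (compl A)
    have "(LINT y|lborel. indicat_real (UNIV - A) y *\<^sub>R u y) = (LINT y|lborel. u y - indicat_real A y *\<^sub>R u y)"
      by (rule Bochner_Integration.integral_cong) (auto simp: indicator_def)
    also have "\<dots> = 0" using compl u int by (simp add: U)
    finally show ?case using compl by auto
  next
    case (union A)
    have m: "\<And>i. A i \<in> sets borel" and z: "\<And>i. (LINT y|lborel. indicat_real (A i) y *\<^sub>R u y) = 0"
      using union by auto
    have "(LINT y|lborel. indicat_real (\<Union>i. A i) y *\<^sub>R u y) = (\<Sum>i. (LINT y|lborel. indicat_real (A i) y *\<^sub>R u y))"
      using lebesgue_integral_countable_add[of A lborel u] m union(1) int[of "\<Union>i. A i"]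
      by (auto simp: set_lebesgue_integral_def set_integrable_def disjoint_family_on_def)
    then show ?case using m z by auto
  qed
  then show "set_lebesgue_integral lborel A u = 0" by (simp add: set_lebesgue_integral_def)
qed

section \<open>Rapid decay of inverse Fourier transforms\<close>

lemma Ck_has_derivative:
  assumes "Ck (Suc k) f"
  shows "(f has_derivative frechet_derivative f (at x)) (at x)"
  using assms frechet_derivative_works by auto

lemma Ck_continuous: "Ck k f \<Longrightarrow> continuous_on UNIV f"
  by (cases k) (auto simp: continuous_on_eq_continuous_at differentiable_imp_continuous_within)

lemma Cc_infinity_continuous: "f \<in> Cc_infinity U \<Longrightarrow> continuous_on UNIV f"
  by (rule Ck_continuous[of 0]) (simp only: Cc_infinity_def mem_Collect_eq)

text \<open>
  Off the support of \<open>f\<close> the derivative vanishes, because the complement of the support is open.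
\<close>

lemma Cc_infinity_frechet_derivative:
  assumes "f \<in> Cc_infinity U"
  shows "(\<lambda>x. frechet_derivative f (at x) u) \<in> Cc_infinity U"
proof -
  let ?g = "\<lambda>x. frechet_derivative f (at x) u"
  let ?S = "closure {x. f x \<noteq> 0}"
  have "Ck k ?g" for k
    using assms by (auto simp: Cc_infinity_def dest: spec[of _ "Suc k"])
  have "?g x = 0" if "x \<notin> ?S" for x
  proof -
    have "(f has_derivative (\<lambda>_. 0)) (at x)"
    proof (rule has_derivative_transform_within_open[of "\<lambda>_. 0" _ _ _ "- ?S"])
      show "0 = f y" if "y \<in> - ?S" for y
        using that closure_subset[of "{x. f x \<noteq> 0}"] by auto
    qed (use that in auto)
    then show ?thesis by (simp add: frechet_derivative_at[symmetric])
  qed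
  then have "{x. ?g x \<noteq> 0} \<subseteq> ?S" by blast
  then have S: "closure {x. ?g x \<noteq> 0} \<subseteq> ?S" by (rule closure_minimal) simp
  moreover have "compact ?S" "?S \<subseteq> U" using assms by (auto simp: Cc_infinity_def)
  moreover have "compact (closure {x. ?g x \<noteq> 0})"
    using compact_Int_closed[of ?S "closure {x. ?g x \<noteq> 0}"] S \<open>compact ?S\<close> by (simp add: Int_absorb1)
  ultimately show ?thesis using \<open>\<And>k. Ck k ?g\<close> by (auto simp: Cc_infinity_def)
qed

lemma Cc_infinity_bounded:
  assumes "f \<in> Cc_infinity U"
  shows "\<exists>R B. 0 \<le> R \<and> 0 \<le> B \<and> (\<forall>x. norm (f x) \<le> B) \<and> (\<forall>x. R < norm x \<longrightarrow> f x = 0)"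
proof -
  let ?S = "closure {x. f x \<noteq> 0}"
  have S: "compact ?S" and c: "continuous_on UNIV f"
    using assms Cc_infinity_continuous[OF assms] by (auto simp: Cc_infinity_def)
  obtain R where R: "\<And>x. x \<in> ?S \<Longrightarrow> norm x \<le> R"
    using compact_imp_bounded[OF S] by (auto simp: bounded_iff)
  have "compact (f ` ?S)" by (rule compact_continuous_image[OF continuous_on_subset[OF c] S]) simp
  then have "bounded (f ` ?S)" by (rule compact_imp_bounded)
  then obtain B where B: "\<And>x. x \<in> ?S \<Longrightarrow> norm (f x) \<le> B"
    unfolding bounded_iff by blast
  have z: "f x = 0" if "x \<notin> ?S" for x
    using that closure_subset[of "{x. f x \<noteq> 0}"] by auto
  have "norm (f x) \<le> max B 0" for x
    using B[of x] z[of x] by (cases "x \<in> ?S") (auto simp: le_max_iff_disj)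
  moreover have "f x = 0" if "max R 0 < norm x" for x
    using R[of x] z[of x] that by fastforce
  ultimately show ?thesis by (intro exI[of _ "max R 0"] exI[of _ "max B 0"]) auto
qed

lemma integrable_bounded_compact_support:
  fixes f :: "'a::euclidean_space \<Rightarrow> complex"
  assumes f: "f \<in> borel_measurable borel" and B: "\<And>x. norm (f x) \<le> B" and R: "\<And>x. R < norm x \<Longrightarrow> f x = 0"
  shows "integrable lborel f"
proof (rule Bochner_Integration.integrable_bound)
  have "emeasure lborel (cball (0::'a) R) < \<infinity>"
    by (rule emeasure_bounded_finite) simp
  then show "integrable lborel (\<lambda>x::'a. B * indicat_real (cball 0 R) x)"
    by (intro integrable_mult_right integrable_real_indicator) auto
  have B0: "0 \<le> B" using B[of 0] norm_ge_zero order_trans by blast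
  show "AE x in lborel. norm (f x) \<le> norm (B * indicat_real (cball 0 R) x)"
    using B R B0 by (auto simp: indicator_def not_le)
qed (use f in simp)

lemma Cc_infinity_integrable:
  assumes "f \<in> Cc_infinity U"
  shows "integrable lborel f"
proof -
  obtain R B where R: "\<And>x. norm (f x) \<le> B" "\<And>x. R < norm x \<Longrightarrow> f x = 0"
    using Cc_infinity_bounded[OF assms] by blast
  show ?thesis
    by (rule integrable_bounded_compact_support[OF borel_measurable_continuous_onI[OF Cc_infinity_continuous[OF assms]] R])
qed

text \<open>
  The derivative as a limit along a sequence, the form needed for dominated convergence.
\<close>

lemma difference_quotient_tendsto:
  fixes g :: "real \<Rightarrow> 'a::real_normed_vector"
  assumes g: "(g has_vector_derivative D) (at 0)" and e0: "filterlim e (at 0) sequentially" and e: "\<And>n. 0 < e n"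
  shows "(\<lambda>n. (g (e n) - g 0) /\<^sub>R e n) \<longlonglongrightarrow> D"
proof -
  have "(\<lambda>h. norm (g (0 + h) - g 0 - h *\<^sub>R D) / norm h) \<midarrow>0\<rightarrow> 0"
    using g unfolding has_vector_derivative_def has_derivative_at by blast
  from filterlim_compose[OF this e0]
  have "(\<lambda>n. norm (g (0 + e n) - g 0 - e n *\<^sub>R D) / norm (e n)) \<longlonglongrightarrow> 0" .
  moreover have "norm (g (0 + e n) - g 0 - e n *\<^sub>R D) / norm (e n) = norm ((g (e n) - g 0) /\<^sub>R e n - D)" for n
  proof -
    have "(g (e n) - g 0) /\<^sub>R e n - D = (g (0 + e n) - g 0 - e n *\<^sub>R D) /\<^sub>R e n"
      using e[of n] by (simp add: scaleR_diff_right)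
    then show ?thesis using e[of n] by (simp add: divide_inverse mult.commute)
  qed
  ultimately have "(\<lambda>n. norm ((g (e n) - g 0) /\<^sub>R e n - D)) \<longlonglongrightarrow> 0" by simp
  then show ?thesis by (simp add: tendsto_norm_zero_iff LIM_zero_iff)
qed

text \<open>
  Integration by parts without boundary terms, obtained from translation invariance: the inverse
  transform of a difference quotient of \<open>f\<close> is a difference quotient of a character times the
  inverse transform of \<open>f\<close>. The quotients are bounded by the supremum of the derivative and live
  in one ball, so both sides converge.
\<close>

lemma inv_fourier_derivative:
  fixes f :: "real^'n \<Rightarrow> complex"
  assumes f: "f \<in> Cc_infinity U"
  shows "inv_fourier (\<lambda>\<xi>. frechet_derivative f (at \<xi>) u) x = - (2 * pi * (x \<bullet> u)) * \<i> * inv_fourier f x"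
proof -
  let ?g = "\<lambda>\<xi>. frechet_derivative f (at \<xi>) u"
  \<comment> \<open>Step sizes at most \<open>1\<close> keep the supports of all difference quotients in one ball.\<close>
  define e where "e n = inverse (real (Suc n))" for n
  have e: "0 < e n" "e n \<le> 1" for n by (simp_all add: e_def inverse_le_1_iff)
  have e0: "filterlim e (at 0) sequentially"
    unfolding filterlim_at using LIMSEQ_inverse_real_of_nat less_imp_neq[OF e(1)] by (simp add: e_def[abs_def] del: of_nat_Suc)
  let ?q = "\<lambda>n \<xi>. (f (\<xi> + e n *\<^sub>R u) - f \<xi>) /\<^sub>R e n"
  have g: "?g \<in> Cc_infinity U" by (rule Cc_infinity_frechet_derivative[OF f])
  have der: "(f has_derivative frechet_derivative f (at \<xi>)) (at \<xi>)" for \<xi>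
    by (rule Ck_has_derivative[of 0]) (use f in \<open>simp only: Cc_infinity_def mem_Collect_eq\<close>)
  have [measurable]: "f \<in> borel_measurable borel" "?g \<in> borel_measurable borel"
    by (rule borel_measurable_continuous_onI, rule Cc_infinity_continuous, fact f,
        rule borel_measurable_continuous_onI, rule Cc_infinity_continuous, fact g)
  obtain R where R: "0 \<le> R" "\<And>x. R < norm x \<Longrightarrow> f x = 0"
    using Cc_infinity_bounded[OF f] by blast
  obtain B where B: "0 \<le> B" "\<And>x. norm (?g x) \<le> B"
    using Cc_infinity_bounded[OF g] by blast
  have fi: "integrable lborel f" by (rule Cc_infinity_integrable[OF f])
  have line: "((\<lambda>t. f (\<xi> + t *\<^sub>R u)) has_vector_derivative ?g (\<xi> + t *\<^sub>R u)) (at t within S)" for \<xi> t S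
  proof -
    have lin: "linear (frechet_derivative f (at (\<xi> + t *\<^sub>R u)))"
      using der has_derivative_linear by blast
    have "((\<lambda>t. f (\<xi> + t *\<^sub>R u)) has_derivative (\<lambda>s. frechet_derivative f (at (\<xi> + t *\<^sub>R u)) (s *\<^sub>R u))) (at t within S)"
      by (rule has_derivative_compose[of "\<lambda>t. \<xi> + t *\<^sub>R u" "\<lambda>s. s *\<^sub>R u", OF _ der])
        (auto intro!: derivative_eq_intros)
    then show ?thesis
      unfolding has_vector_derivative_def by (simp add: linear_scale[OF lin])
  qed
  have qB: "norm (?q n \<xi>) \<le> B" for n \<xi>
  proof -
    have "norm (f (\<xi> + e n *\<^sub>R u) - f (\<xi> + 0 *\<^sub>R u)) \<le> B * norm (e n - 0)"
    proof (rule differentiable_bound[of "{0..e n}" "\<lambda>t. f (\<xi> + t *\<^sub>R u)" "\<lambda>t s. s *\<^sub>R ?g (\<xi> + t *\<^sub>R u)"])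
      show "((\<lambda>t. f (\<xi> + t *\<^sub>R u)) has_derivative (\<lambda>s. s *\<^sub>R ?g (\<xi> + t *\<^sub>R u))) (at t within {0..e n})" for t
        using line unfolding has_vector_derivative_def .
      show "onorm (\<lambda>s. s *\<^sub>R ?g (\<xi> + t *\<^sub>R u)) \<le> B" for t
        using B by (intro onorm_le) (simp add: mult.commute[of B] mult_left_mono)
    qed (use e(1)[of n] in \<open>auto simp: less_imp_le\<close>)
    then show ?thesis using e[of n] by (simp add: divide_simps mult.commute)
  qed
  have qR: "?q n \<xi> = 0" if "R + norm u < norm \<xi>" for n \<xi>
  proof -
    have "norm (e n *\<^sub>R u) \<le> norm u"
      using e[of n] by (simp add: mult_left_le_one_le)
    moreover have "norm \<xi> \<le> norm (\<xi> + e n *\<^sub>R u) + norm (e n *\<^sub>R u)"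
      using norm_triangle_ineq4[of "\<xi> + e n *\<^sub>R u" "e n *\<^sub>R u"] by simp
    ultimately have "R < norm (\<xi> + e n *\<^sub>R u)" "R < norm \<xi>"
      using that norm_ge_zero[of u] by linarith+
    then show ?thesis using R by simp
  qed
  have qlim: "(\<lambda>n. ?q n \<xi>) \<longlonglongrightarrow> ?g \<xi>" for \<xi>
  proof -
    have "((\<lambda>t. f (\<xi> + t *\<^sub>R u)) has_vector_derivative ?g \<xi>) (at 0)"
      using line[of \<xi> 0 UNIV] by simp
    from difference_quotient_tendsto[OF this e0 e(1)] show ?thesis by simp
  qed
  have lim: "(\<lambda>n. inv_fourier (?q n) x) \<longlonglongrightarrow> inv_fourier ?g x"
    unfolding inv_fourier_def
  proof (rule integral_dominated_convergence[where w="\<lambda>\<xi>. B * indicat_real (cball 0 (R + norm u)) \<xi>"])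
    have "emeasure lborel (cball (0::real^'n) (R + norm u)) < \<infinity>"
      by (rule emeasure_bounded_finite) simp
    then show "integrable lborel (\<lambda>\<xi>::real^'n. B * indicat_real (cball 0 (R + norm u)) \<xi>)"
      by (intro integrable_mult_right integrable_real_indicator) auto
    show "AE \<xi> in lborel. (\<lambda>n. ?q n \<xi> * cis (2 * pi * (x \<bullet> \<xi>))) \<longlonglongrightarrow> ?g \<xi> * cis (2 * pi * (x \<bullet> \<xi>))"
      by (intro AE_I2 tendsto_mult_right qlim)
    show "AE \<xi> in lborel. norm (?q n \<xi> * cis (2 * pi * (x \<bullet> \<xi>))) \<le> B * indicat_real (cball 0 (R + norm u)) \<xi>" for n
    proof (rule AE_I2)
      fix \<xi> :: "real^'n"
      have "norm (?q n \<xi>) \<le> B * indicat_real (cball 0 (R + norm u)) \<xi>"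
      proof (cases "R + norm u < norm \<xi>")
        case True
        show ?thesis unfolding qR[OF True] using B(1) by (simp add: indicator_def)
      next
        case False
        then show ?thesis using qB[of n \<xi>] by (simp add: indicator_def)
      qed
      then show "norm (?q n \<xi> * cis (2 * pi * (x \<bullet> \<xi>))) \<le> B * indicat_real (cball 0 (R + norm u)) \<xi>"
        by (simp only: norm_mult norm_cis mult_1_right)
    qed
  qed measurable
  have eq: "inv_fourier (?q n) x = ((cis (- (2 * pi * (x \<bullet> u)) * e n) - cis 0) /\<^sub>R e n) * inv_fourier f x" for n
  proof -
    let ?h = "\<lambda>\<xi>. f \<xi> * cis (2 * pi * (x \<bullet> \<xi>))"
    have hi: "integrable lborel ?h" by (rule integrable_mult_cis[OF fi]) simp
    have hi': "integrable lborel (\<lambda>\<xi>. ?h (e n *\<^sub>R u + 1 *\<^sub>R \<xi>))"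
      by (rule integral_scaling(1)[OF _ hi]) simp
    have h': "(LINT \<xi>|lborel. ?h (e n *\<^sub>R u + 1 *\<^sub>R \<xi>)) = inv_fourier f x"
      using integral_scaling(2)[OF _ hi, of 1 "e n *\<^sub>R u"] by (simp add: inv_fourier_def)
    let ?c = "cis (- (2 * pi * (x \<bullet> u)) * e n)"
    have "?q n \<xi> * cis (2 * pi * (x \<bullet> \<xi>)) = (?c * ?h (e n *\<^sub>R u + 1 *\<^sub>R \<xi>) - ?h \<xi>) /\<^sub>R e n" for \<xi>
    proof -
      have "?c * cis (2 * pi * (x \<bullet> (e n *\<^sub>R u + 1 *\<^sub>R \<xi>))) = cis (2 * pi * (x \<bullet> \<xi>))"
        by (simp add: cis_mult inner_add_right algebra_simps)
      then have "?c * ?h (e n *\<^sub>R u + 1 *\<^sub>R \<xi>) = f (\<xi> + e n *\<^sub>R u) * cis (2 * pi * (x \<bullet> \<xi>))"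
        by (simp add: add.commute mult.left_commute)
      then show ?thesis by (simp add: left_diff_distrib)
    qed
    then have "inv_fourier (?q n) x = (LINT \<xi>|lborel. (?c * ?h (e n *\<^sub>R u + 1 *\<^sub>R \<xi>) - ?h \<xi>) /\<^sub>R e n)"
      unfolding inv_fourier_def by presburger
    also have "\<dots> = (?c * inv_fourier f x - inv_fourier f x) /\<^sub>R e n"
      using hi hi' by (subst integral_scaleR_right, subst Bochner_Integration.integral_diff)
        (simp_all only: integrable_mult_right integral_mult_right_zero h', simp_all add: inv_fourier_def)
    finally show ?thesis by (simp add: algebra_simps)
  qed
  have "(\<lambda>n. (cis (- (2 * pi * (x \<bullet> u)) * e n) - cis 0) /\<^sub>R e n) \<longlonglongrightarrow> - (2 * pi * (x \<bullet> u)) * \<i>"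
  proof -
    let ?a = "- (2 * pi * (x \<bullet> u))"
    have "((\<lambda>t. cis (?a * t)) has_vector_derivative (?a *\<^sub>R (\<i> * cis (?a * 0)))) (at 0)"
    proof -
      have "((\<lambda>z. exp (\<i> * of_real ?a * z)) has_field_derivative ?a *\<^sub>R (\<i> * cis (?a * 0))) (at (of_real 0))"
        by (auto intro!: derivative_eq_intros simp: scaleR_conv_of_real)
      from has_vector_derivative_real_field[OF this]
      show ?thesis by (simp add: cis_conv_exp mult.assoc)
    qed
    from difference_quotient_tendsto[OF this e0 e(1)]
    have "(\<lambda>n. (cis (?a * e n) - cis (?a * 0)) /\<^sub>R e n) \<longlonglongrightarrow> ?a *\<^sub>R (\<i> * cis (?a * 0))" .
    then show ?thesis by (simp add: scaleR_conv_of_real)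
  qed
  then have "(\<lambda>n. ((cis (- (2 * pi * (x \<bullet> u)) * e n) - cis 0) /\<^sub>R e n) * inv_fourier f x) \<longlonglongrightarrow> - (2 * pi * (x \<bullet> u)) * \<i> * inv_fourier f x"
    by (rule tendsto_mult_right)
  then have "(\<lambda>n. inv_fourier (?q n) x) \<longlonglongrightarrow> - (2 * pi * (x \<bullet> u)) * \<i> * inv_fourier f x"
    unfolding eq .
  with lim show ?thesis by (rule LIMSEQ_unique)
qed

text \<open>
  Multiplication by a coordinate corresponds to differentiation, so each further factor \<open>1 + \<bar>x\<bar>\<close>,
  which is at most \<open>1\<close> plus the sum of the absolute coordinates, is paid for by one more
  derivative of \<open>f\<close>.
\<close>

lemma inv_fourier_rapid_decay:
  fixes f :: "real^'n \<Rightarrow> complex"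
  assumes "f \<in> Cc_infinity U"
  shows "\<exists>C. \<forall>x. (1 + norm x) ^ N * norm (inv_fourier f x) \<le> C"
  using assms
proof (induction N arbitrary: f)
  case 0
  then show ?case using norm_inv_fourier_le[of f] by auto
next
  case (Suc N)
  let ?d = "\<lambda>i \<xi>. frechet_derivative f (at \<xi>) (axis i 1)"
  obtain C where C: "\<And>x. (1 + norm x) ^ N * norm (inv_fourier f x) \<le> C"
    using Suc.IH[OF Suc.prems] by blast
  have "\<forall>i. \<exists>C. \<forall>x. (1 + norm x) ^ N * norm (inv_fourier (?d i) x) \<le> C"
    using Suc.IH[OF Cc_infinity_frechet_derivative[OF Suc.prems]] by blast
  then obtain D where D: "\<And>i x. (1 + norm x) ^ N * norm (inv_fourier (?d i) x) \<le> D i"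
    by metis
  have "(1 + norm x) ^ Suc N * norm (inv_fourier f x) \<le> C + (\<Sum>i\<in>UNIV. D i)" for x
  proof -
    \<comment> \<open>The factor \<open>2 \<pi>\<close> of the differentiation rule exceeds \<open>1\<close> and is dropped.\<close>
    have le: "\<bar>x $ i\<bar> * norm (inv_fourier f x) \<le> norm (inv_fourier (?d i) x)" for i
    proof -
      have "norm (inv_fourier (?d i) x) = 2 * pi * (\<bar>x $ i\<bar> * norm (inv_fourier f x))"
        unfolding inv_fourier_derivative[OF Suc.prems] by (simp add: norm_mult inner_axis)
      moreover have "1 * (\<bar>x $ i\<bar> * norm (inv_fourier f x)) \<le> 2 * pi * (\<bar>x $ i\<bar> * norm (inv_fourier f x))"
        using pi_gt3 by (intro mult_right_mono) auto
      ultimately show ?thesis by simp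
    qed
    have "(1 + norm x) ^ Suc N * norm (inv_fourier f x)
        = (1 + norm x) ^ N * (norm (inv_fourier f x) + norm x * norm (inv_fourier f x))"
      by (simp add: algebra_simps)
    also have "\<dots> \<le> (1 + norm x) ^ N * (norm (inv_fourier f x) + (\<Sum>i\<in>UNIV. \<bar>x $ i\<bar>) * norm (inv_fourier f x))"
      by (intro mult_left_mono add_left_mono mult_right_mono norm_le_l1_cart) auto
    also have "\<dots> \<le> (1 + norm x) ^ N * (norm (inv_fourier f x) + (\<Sum>i\<in>UNIV. norm (inv_fourier (?d i) x)))"
      unfolding sum_distrib_right by (intro mult_left_mono add_left_mono sum_mono le) auto
    also have "\<dots> \<le> C + (\<Sum>i\<in>UNIV. D i)"
      unfolding distrib_left sum_distrib_left by (intro add_mono sum_mono C D)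
    finally show ?thesis .
  qed
  then show ?case by blast
qed

text \<open>
  Compare with the product of the functions \<open>1 / (1 + t\<^sup>2)\<close> of the single coordinates; the
  exponent is twice the dimension.
\<close>

lemma integrable_inverse_power:
  "\<exists>N. integrable lborel (\<lambda>x::'a::euclidean_space. inverse ((1 + norm x) ^ N))"
proof -
  have 1: "integrable lborel (\<lambda>t::real. inverse (1 + t\<^sup>2))"
    using integrable_inverse_1_plus_square by (simp add: set_integrable_def einterval_def)
  have i: "integrable lborel (\<lambda>x::'a. \<Prod>b\<in>Basis. inverse (1 + (x \<bullet> b)\<^sup>2))"
    by (rule integral_lborel_prod(1)[OF 1])
  have "integrable lborel (\<lambda>x::'a. inverse ((1 + norm x) ^ (2 * DIM('a))))"
  proof (rule Bochner_Integration.integrable_bound[OF i])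
    show "AE x in lborel. norm (inverse ((1 + norm x) ^ (2 * DIM('a)))) \<le> norm (\<Prod>b\<in>Basis. inverse (1 + (x \<bullet> (b::'a))\<^sup>2))"
    proof (rule AE_I2)
      fix x :: 'a
      have b: "1 + (x \<bullet> b)\<^sup>2 \<le> (1 + norm x)\<^sup>2" if "b \<in> Basis" for b
      proof -
        have "(x \<bullet> b)\<^sup>2 \<le> (norm x)\<^sup>2"
          using Basis_le_norm[OF that, of x] by (simp add: abs_le_square_iff[symmetric])
        then have "1 + (x \<bullet> b)\<^sup>2 \<le> 1 + (norm x)\<^sup>2 + 2 * norm x"
          using norm_ge_zero[of x] by linarith
        then show ?thesis by (simp add: power2_sum)
      qed
      have "inverse ((1 + norm x) ^ (2 * DIM('a))) = (\<Prod>b\<in>(Basis::'a set). inverse ((1 + norm x)\<^sup>2))"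
        by (simp add: power_mult power_inverse)
      also have "\<dots> \<le> (\<Prod>b\<in>(Basis::'a set). inverse (1 + (x \<bullet> b)\<^sup>2))"
        by (intro prod_mono conjI le_imp_inverse_le b) (auto simp: add_pos_nonneg)
      finally show "norm (inverse ((1 + norm x) ^ (2 * DIM('a)))) \<le> norm (\<Prod>b\<in>Basis. inverse (1 + (x \<bullet> (b::'a))\<^sup>2))"
        by (simp add: prod_nonneg)
    qed
  qed simp
  then show ?thesis by blast
qed

lemma inv_fourier_moments:
  fixes f :: "real^'n \<Rightarrow> complex"
  assumes f: "f \<in> Cc_infinity U"
  shows "integrable lborel (\<lambda>x. (1 + norm x) powr s * norm (inv_fourier f x))"
proof -
  have [measurable]: "f \<in> borel_measurable borel"
    using Cc_infinity_integrable[OF f] by (simp add: borel_measurable_integrable)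
  \<comment> \<open>Of the available decay, \<open>k \<ge> s\<close> powers absorb the weight and \<open>N\<close> powers give integrability.\<close>
  obtain N where N: "integrable lborel (\<lambda>x::real^'n. inverse ((1 + norm x) ^ N))"
    using integrable_inverse_power by blast
  obtain k where k: "s \<le> real k" using real_arch_simple by blast
  obtain C where C: "\<And>x. (1 + norm x) ^ (k + N) * norm (inv_fourier f x) \<le> C"
    using inv_fourier_rapid_decay[OF f] by blast
  have "0 \<le> (1 + norm (0::real^'n)) ^ (k + N) * norm (inv_fourier f 0)" by simp
  also note C
  finally have C0: "0 \<le> C" .
  show ?thesis
  proof (rule Bochner_Integration.integrable_bound)
    show "integrable lborel (\<lambda>x::real^'n. C * inverse ((1 + norm x) ^ N))" using N by simp
    show "AE x in lborel. norm ((1 + norm x) powr s * norm (inv_fourier f x)) \<le> norm (C * inverse ((1 + norm x) ^ N))"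
    proof (rule AE_I2)
      fix x :: "real^'n"
      have p: "0 < 1 + norm x" by (simp add: add_pos_nonneg)
      have "(1 + norm x) powr s \<le> (1 + norm x) powr real k"
        by (rule powr_mono[OF k]) simp
      also have "\<dots> = (1 + norm x) ^ k" by (rule powr_realpow[OF p])
      finally have "(1 + norm x) powr s * norm (inv_fourier f x) \<le> (1 + norm x) ^ k * norm (inv_fourier f x)"
        by (rule mult_right_mono) simp
      also have "\<dots> \<le> C * inverse ((1 + norm x) ^ N)"
        using C[of x] p by (simp add: divide_inverse[symmetric] pos_le_divide_eq power_add mult_ac)
      finally show "norm ((1 + norm x) powr s * norm (inv_fourier f x)) \<le> norm (C * inverse ((1 + norm x) ^ N))"
        using C0 p by (simp add: abs_mult)
    qed
  qed measurable
qed

lemma inv_fourier_integrable: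
  fixes f :: "real^'n \<Rightarrow> complex"
  assumes f: "f \<in> Cc_infinity U"
  shows "integrable lborel (inv_fourier f)"
proof -
  have "f \<in> borel_measurable borel"
    using Cc_infinity_integrable[OF f] by (simp add: borel_measurable_integrable)
  moreover have "integrable lborel (\<lambda>x. norm (inv_fourier f x))"
    using inv_fourier_moments[OF f, of 0] by (simp add: add_nonneg_eq_0_iff)
  ultimately show ?thesis by (simp add: integrable_norm_iff)
qed

lemma Cc_infinity_fourier_inversion:
  fixes f :: "real^'n \<Rightarrow> complex"
  assumes f: "f \<in> Cc_infinity U"
  shows "fourier (inv_fourier f) = f"
proof -
  obtain B where B: "\<forall>x. norm (f x) \<le> B" using Cc_infinity_bounded[OF f] by blast
  from fourier_inv_fourier[OF Cc_infinity_integrable[OF f] Cc_infinity_continuous[OF f] B[rule_format] inv_fourier_integrable[OF f]]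
  show ?thesis .
qed

text \<open>
  By injectivity of the Fourier transform, \<open>\<psi>\<close> agrees almost everywhere with the inverse transform
  of its Fourier transform, and the latter decays rapidly.
\<close>

lemma Finv_Cc_infinity_moments:
  fixes \<psi> :: "real^'n \<Rightarrow> complex"
  assumes "\<psi> \<in> Finv_Cc_infinity U"
  shows "integrable lborel (\<lambda>x. (1 + norm x) powr s * norm (\<psi> x))"
proof -
  let ?p = "inv_fourier (fourier \<psi>)"
  have i: "integrable lborel \<psi>" and f: "fourier \<psi> \<in> Cc_infinity U"
    using assms by (auto simp: Finv_Cc_infinity_def)
  have p: "integrable lborel ?p" by (rule inv_fourier_integrable[OF f])
  have [measurable]: "\<psi> \<in> borel_measurable borel" "?p \<in> borel_measurable borel"
    using i p by (simp_all add: borel_measurable_integrable)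
  have "AE x in lborel. \<psi> x - ?p x = 0"
  proof (rule fourier_injective)
    show "integrable lborel (\<lambda>x. \<psi> x - ?p x)" using i p by simp
    fix \<xi>
    have "fourier (\<lambda>x. \<psi> x - ?p x) \<xi> = fourier \<psi> \<xi> - fourier ?p \<xi>"
      unfolding fourier_cis[of _ \<xi>] left_diff_distrib
      by (intro Bochner_Integration.integral_diff integrable_mult_cis i p) simp_all
    then show "fourier (\<lambda>x. \<psi> x - ?p x) \<xi> = 0"
      by (simp add: Cc_infinity_fourier_inversion[OF f])
  qed
  then have "AE x in lborel. (1 + norm x) powr s * norm (?p x) = (1 + norm x) powr s * norm (\<psi> x)"
    by eventually_elim simp
  then show ?thesis
    using inv_fourier_moments[OF f, of s] by (subst (asm) integrable_cong_AE) simp_all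
qed

section \<open>Smooth bump functions\<close>

text \<open>
  The classical flat function \<open>exp (-1/t)\<close>, extended by zero, divided by a power of \<open>t\<close>: the
  powers make the family closed under differentiation.
\<close>

definition flat_exp :: "nat \<Rightarrow> real \<Rightarrow> real" where
  "flat_exp m t = (if 0 < t then exp (- 1 / t) / t ^ m else 0)"

text \<open>
  The exponential dominates powers: \<open>exp (1/t) \<ge> (1 / (n t))\<^sup>n\<close> with \<open>n = m + 1\<close>.
\<close>

lemma flat_exp_le: "\<bar>flat_exp m t\<bar> \<le> real (Suc m) ^ Suc m * \<bar>t\<bar>"
proof (cases "0 < t")
  case True
  let ?n = "Suc m"
  have "(1 / t / real ?n) ^ ?n \<le> (1 + (1 / t) / real ?n) ^ ?n"
    using True by (intro power_mono) auto
  also have "\<dots> \<le> exp (1 / t)"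
    by (rule exp_ge_one_plus_x_over_n_power_n) (use True in \<open>auto intro: order_trans[of _ 0]\<close>)
  finally have "1 / (t * real ?n) ^ ?n \<le> exp (1 / t)"
    by (simp only: divide_divide_eq_left power_divide power_one)
  moreover have "0 < (t * real ?n) ^ ?n" using True by (intro zero_less_power mult_pos_pos) simp_all
  ultimately have "1 \<le> exp (1 / t) * (t * real ?n) ^ ?n"
    by (simp only: pos_divide_le_eq)
  then have "exp (- 1 / t) * 1 \<le> exp (- 1 / t) * (exp (1 / t) * (t * real ?n) ^ ?n)"
    by (rule mult_left_mono) simp
  also have "\<dots> = (t * real ?n) ^ ?n"
    by (simp add: mult.assoc[symmetric] exp_add[symmetric])
  finally show ?thesis
    using True by (simp add: flat_exp_def power_mult_distrib pos_divide_le_eq mult_ac)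
next
  case False
  then have "flat_exp m t = 0" by (simp add: flat_exp_def)
  then show ?thesis by (simp only: abs_zero) (intro mult_nonneg_nonneg zero_le_power, simp_all)
qed

text \<open>
  At the origin the difference quotient of \<open>flat_exp m\<close> is \<open>flat_exp (Suc m)\<close>, which tends to \<open>0\<close>.
\<close>

lemma DERIV_flat_exp:
  "DERIV (flat_exp m) t :> - real m * flat_exp (Suc m) t + flat_exp (Suc (Suc m)) t"
proof -
  consider "0 < t" | "t < 0" | "t = 0" by linarith
  then show ?thesis
  proof cases
    case 1
    \<comment> \<open>Induction on \<open>m\<close>, by multiplying with \<open>1 / t\<close>, avoids the exponent \<open>m - 1\<close> of the power rule.\<close>
    have "DERIV (\<lambda>t. exp (- 1 / t) / t ^ m) t :> - real m * (exp (- 1 / t) / t ^ Suc m) + exp (- 1 / t) / t ^ Suc (Suc m)"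
    proof (induction m)
      case 0
      show ?case using 1 by (auto intro!: derivative_eq_intros simp: field_simps)
    next
      case (Suc m)
      have "DERIV (\<lambda>t. 1 / t) t :> - (1 / (t * t))"
        using 1 by (auto intro!: derivative_eq_intros)
      from DERIV_mult[OF Suc.IH this]
      have "DERIV (\<lambda>t. exp (- 1 / t) / t ^ Suc m) t :>
        (- real m * (exp (- 1 / t) / t ^ Suc m) + exp (- 1 / t) / t ^ Suc (Suc m)) * (1 / t) + - (1 / (t * t)) * (exp (- 1 / t) / t ^ m)"
        by (simp add: mult.commute)
      then show ?case
        by (rule DERIV_cong) (use 1 in \<open>simp add: field_simps\<close>)
    qed
    then have "DERIV (\<lambda>t. exp (- 1 / t) / t ^ m) t :> - real m * flat_exp (Suc m) t + flat_exp (Suc (Suc m)) t"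
      using 1 by (simp add: flat_exp_def)
    then show ?thesis
      by (rule has_field_derivative_transform_within_open[of _ _ _ "{0<..}"]) (use 1 in \<open>auto simp: flat_exp_def\<close>)
  next
    case 2
    have "DERIV (\<lambda>t. 0) t :> - real m * flat_exp (Suc m) t + flat_exp (Suc (Suc m)) t"
      using 2 by (simp add: flat_exp_def)
    then show ?thesis
      by (rule has_field_derivative_transform_within_open[of _ _ _ "{..<0}"]) (use 2 in \<open>auto simp: flat_exp_def\<close>)
  next
    case 3
    have "((\<lambda>h. flat_exp (Suc m) h) \<longlongrightarrow> 0) (at 0)"
    proof (rule Lim_null_comparison)
      show "\<forall>\<^sub>F h in at 0. norm (flat_exp (Suc m) h) \<le> real (Suc (Suc m)) ^ Suc (Suc m) * \<bar>h\<bar>"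
        by (intro always_eventually allI) (simp only: real_norm_def flat_exp_le)
      have "((\<lambda>h::real. real (Suc (Suc m)) ^ Suc (Suc m) * \<bar>h\<bar>) \<longlongrightarrow> real (Suc (Suc m)) ^ Suc (Suc m) * \<bar>0\<bar>) (at 0)"
        by (intro tendsto_intros)
      then show "((\<lambda>h::real. real (Suc (Suc m)) ^ Suc (Suc m) * \<bar>h\<bar>) \<longlongrightarrow> 0) (at 0)" by simp
    qed
    moreover have "(flat_exp m (0 + h) - flat_exp m 0) / h = flat_exp (Suc m) h" for h
      by (simp add: flat_exp_def field_simps)
    ultimately show ?thesis using 3 by (simp add: DERIV_def flat_exp_def)
  qed
qed

text \<open>
  An algebra of functions that contains the bumps and is closed under directional derivatives. Its
  members are therefore smooth in the recursive sense of \<open>Ck\<close>.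
\<close>

inductive bump_algebra :: "('a::euclidean_space \<Rightarrow> complex) \<Rightarrow> bool" where
  const: "bump_algebra (\<lambda>x. c)"
| inner: "bump_algebra (\<lambda>x. of_real (x \<bullet> a))"
| flat: "bump_algebra (\<lambda>x. of_real (flat_exp m (r - (x - a) \<bullet> (x - a))))"
| add: "bump_algebra f \<Longrightarrow> bump_algebra g \<Longrightarrow> bump_algebra (\<lambda>x. f x + g x)"
| mult: "bump_algebra f \<Longrightarrow> bump_algebra g \<Longrightarrow> bump_algebra (\<lambda>x. f x * g x)"

lemma bump_algebra_derivative:
  "bump_algebra f \<Longrightarrow> \<exists>f'. (\<forall>x. (f has_derivative f' x) (at x)) \<and> (\<forall>u. bump_algebra (\<lambda>x. f' x u))"
proof (induction rule: bump_algebra.induct)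
  case (const c)
  show ?case
    by (rule exI[of _ "\<lambda>x u. 0"]) (auto intro: bump_algebra.const)
next
  case (inner a)
  show ?case
    by (rule exI[of _ "\<lambda>x u. of_real (u \<bullet> a)"]) (auto intro!: bump_algebra.const derivative_eq_intros)
next
  case (flat m r a)
  let ?q = "\<lambda>x. r - (x - a) \<bullet> (x - a)"
  let ?f' = "\<lambda>x u. (of_real (- real m) * of_real (flat_exp (Suc m) (?q x)) + of_real (flat_exp (Suc (Suc m)) (?q x)))
      * (of_real (-2) * (of_real (x \<bullet> u) + of_real (- (a \<bullet> u)))) :: complex"
  have "((\<lambda>x. complex_of_real (flat_exp m (?q x))) has_derivative ?f' x) (at x)" for x
  proof -
    have "(?q has_derivative (\<lambda>u. - 2 * ((x - a) \<bullet> u))) (at x)"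
      by (auto intro!: derivative_eq_intros simp: inner_commute)
    from has_derivative_compose[OF this DERIV_flat_exp[unfolded has_field_derivative_def]]
    show ?thesis
      by (rule has_derivative_of_real[THEN has_derivative_eq_rhs]) (simp add: fun_eq_iff inner_diff_left algebra_simps)
  qed
  then show ?case
    by (intro exI[of _ ?f'] conjI allI bump_algebra.intros)
next
  case (add f g)
  then obtain f' g' where d: "\<And>x. (f has_derivative f' x) (at x)" "\<And>x. (g has_derivative g' x) (at x)"
    and S: "\<And>u. bump_algebra (\<lambda>x. f' x u)" "\<And>u. bump_algebra (\<lambda>x. g' x u)" by blast
  show ?case
    by (rule exI[of _ "\<lambda>x u. f' x u + g' x u"]) (auto intro!: bump_algebra.add S has_derivative_add d)
next
  case (mult f g)
  then obtain f' g' where d: "\<And>x. (f has_derivative f' x) (at x)" "\<And>x. (g has_derivative g' x) (at x)"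
    and S: "\<And>u. bump_algebra (\<lambda>x. f' x u)" "\<And>u. bump_algebra (\<lambda>x. g' x u)" by blast
  show ?case
    by (rule exI[of _ "\<lambda>x u. f x * g' x u + f' x u * g x"])
      (auto intro!: bump_algebra.add bump_algebra.mult mult.hyps S has_derivative_mult d)
qed

lemma bump_algebra_Ck: "bump_algebra f \<Longrightarrow> Ck k f"
proof (induction k arbitrary: f)
  case 0
  obtain f' where d: "\<And>x. (f has_derivative f' x) (at x)"
    using bump_algebra_derivative[OF 0] by blast
  then show ?case
    by (auto simp: continuous_on_eq_continuous_at intro: has_derivative_continuous)
next
  case (Suc k)
  obtain f' where d: "\<And>x. (f has_derivative f' x) (at x)" and S: "\<And>u. bump_algebra (\<lambda>x. f' x u)"
    using bump_algebra_derivative[OF Suc.prems] by blast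
  have "frechet_derivative f (at x) = f' x" for x
    using frechet_derivative_at[OF d] by simp
  then show ?case using d S Suc.IH by (auto simp: differentiable_def)
qed

text \<open>
  The bump is \<open>exp (-1/t)\<close> evaluated at \<open>t = e\<^sup>2 - \<bar>x - a\<bar>\<^sup>2\<close>, which is positive exactly on the
  ball.
\<close>

lemma Cc_infinity_nonzero:
  fixes U :: "(real^'n) set"
  assumes U: "open U" and a: "a \<in> U"
  shows "\<exists>f\<in>Cc_infinity U. f a \<noteq> 0"
proof -
  obtain e where e: "0 < e" "cball a e \<subseteq> U" using U a open_contains_cball by blast
  let ?f = "\<lambda>x. complex_of_real (flat_exp 0 (e\<^sup>2 - (x - a) \<bullet> (x - a)))"
  have "{x. ?f x \<noteq> 0} \<subseteq> cball a e"
  proof clarify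
    fix x assume "?f x \<noteq> 0"
    then have "(norm (x - a))\<^sup>2 < e\<^sup>2" by (auto simp: flat_exp_def power2_norm_eq_inner split: if_splits)
    then have "norm (x - a) < e" using e(1) by (simp add: power_less_imp_less_base)
    then show "x \<in> cball a e" by (simp add: dist_norm norm_minus_commute)
  qed
  then have S: "closure {x. ?f x \<noteq> 0} \<subseteq> cball a e" by (rule closure_minimal) simp
  have "compact (closure {x. ?f x \<noteq> 0})"
    using compact_Int_closed[OF compact_cball, of "closure {x. ?f x \<noteq> 0}" a e] S by (simp only: Int_absorb1 closed_closure)
  moreover have "Ck k ?f" for k by (rule bump_algebra_Ck[OF bump_algebra.flat])
  ultimately have "?f \<in> Cc_infinity U"
    using order_trans[OF S e(2)] unfolding Cc_infinity_def by (intro CollectI conjI allI)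
  moreover have "?f a \<noteq> 0" using e(1) by (simp add: flat_exp_def)
  ultimately show ?thesis by (intro bexI[of _ ?f])
qed

section \<open>Properness of the dual action\<close>

lemma continuous_on_matrix_mult:
  fixes f :: "'a::topological_space \<Rightarrow> real^'n^'m" and g :: "'a \<Rightarrow> real^'k^'n"
  assumes "continuous_on S f" "continuous_on S g"
  shows "continuous_on S (\<lambda>x. f x ** g x)"
  unfolding matrix_matrix_mult_def by (intro continuous_on_vec_lambda continuous_intros assms)

lemma continuous_on_matrix_vector_mult:
  fixes f :: "'a::topological_space \<Rightarrow> real^'n^'m" and g :: "'a \<Rightarrow> real^'n"
  assumes "continuous_on S f" "continuous_on S g"
  shows "continuous_on S (\<lambda>x. f x *v g x)"
  unfolding matrix_vector_mult_def by (intro continuous_on_vec_lambda continuous_intros assms)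

lemma continuous_on_transpose:
  fixes f :: "'a::topological_space \<Rightarrow> real^'n^'m"
  assumes "continuous_on S f"
  shows "continuous_on S (\<lambda>x. transpose (f x))"
  unfolding transpose_def by (intro continuous_on_vec_lambda continuous_intros assms)

text \<open>
  A bound on \<open>h\<close> alone does not keep it away from the singular matrices; a bound on the inverse
  does. The set is the projection of a closed and bounded set of pairs of mutually inverse
  matrices.
\<close>

lemma closed_subgroup_GL_compact_exhaustion:
  fixes H :: "(real^'n^'n) set"
  assumes H: "closed_subgroup_GL H"
  shows "compact {h \<in> H. norm h \<le> r \<and> norm (matrix_inv h) \<le> r}"
proof -
  from H obtain T where T: "closed T" "H = {h. invertible h} \<inter> T"
    unfolding closed_subgroup_GL_def closedin_closed by blast
  let ?P = "(cball 0 r \<times> cball 0 r) \<inter> {p::(real^'n^'n) \<times> (real^'n^'n). fst p ** snd p = mat 1} \<inter> (fst -` T)"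
  have "closed {p::(real^'n^'n) \<times> (real^'n^'n). fst p ** snd p = mat 1}"
    by (intro closed_Collect_eq continuous_on_matrix_mult continuous_intros)
  moreover have "closed (fst -` T :: ((real^'n^'n) \<times> (real^'n^'n)) set)"
    by (rule closed_vimage[OF T(1)]) (intro continuous_intros)
  ultimately have "compact ?P"
    by (intro compact_Int_closed compact_Times compact_cball)
  then have "compact (fst ` ?P)" by (intro compact_continuous_image continuous_intros)
  also have "fst ` ?P = {h \<in> H. norm h \<le> r \<and> norm (matrix_inv h) \<le> r}"
  proof (intro set_eqI iffI)
    fix h assume "h \<in> fst ` ?P"
    then obtain g where g: "norm h \<le> r" "norm g \<le> r" "h ** g = mat 1" "h \<in> T" by auto
    then have inv: "invertible h" by (auto simp: invertible_def matrix_left_right_inverse)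
    have "matrix_inv h = matrix_inv h ** (h ** g)" by (simp add: g)
    also have "\<dots> = g" by (simp add: matrix_mul_assoc matrix_inv_inverse[OF inv])
    finally show "h \<in> {h \<in> H. norm h \<le> r \<and> norm (matrix_inv h) \<le> r}" using g inv T by auto
  next
    fix h assume h: "h \<in> {h \<in> H. norm h \<le> r \<and> norm (matrix_inv h) \<le> r}"
    then have "(h, matrix_inv h) \<in> ?P" using T by (auto simp: matrix_inv_inverse)
    then show "h \<in> fst ` ?P" by (rule image_eqI[rotated]) simp
  qed
  finally show ?thesis .
qed

text \<open>
  The orbit is the union of countably many compact images. If all had empty interior, the
  complement of the orbit would be dense by Baire's theorem, but the orbit is open and nonempty.
\<close>

lemma dual_orbit_map_image_interior:
  fixes H :: "(real^'n^'n) set" and \<xi>0 :: "real^'n"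
  assumes H: "closed_subgroup_GL H"
    and Orb: "open {transpose h *v \<xi>0 |h. h \<in> H}"
  shows "\<exists>K. compact K \<and> K \<subseteq> H \<and> interior ((\<lambda>h. transpose h *v \<xi>0) ` K) \<noteq> {}"
proof (rule ccontr)
  assume *: "\<not> ?thesis"
  let ?p = "\<lambda>h. transpose h *v \<xi>0"
  define K where "K n = {h \<in> H. norm h \<le> real n \<and> norm (matrix_inv h) \<le> real n}" for n :: nat
  have K: "compact (K n)" "K n \<subseteq> H" for n
    unfolding K_def by (rule closed_subgroup_GL_compact_exhaustion[OF H]) auto
  have i: "interior (?p ` K n) = {}" for n using * K by blast
  have cl: "closed (?p ` K n)" for n
    by (intro compact_imp_closed compact_continuous_image K continuous_on_matrix_vector_mult continuous_on_transpose continuous_intros)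
  have "UNIV \<subseteq> closure (\<Inter> (range (\<lambda>n. - ?p ` K n)))"
  proof (rule Baire)
    fix T assume "T \<in> range (\<lambda>n. - ?p ` K n)"
    then show "openin (top_of_set UNIV) T \<and> UNIV \<subseteq> closure T"
      using cl i by (auto simp: closure_complement open_Compl)
  qed auto
  moreover have "\<Inter> (range (\<lambda>n. - ?p ` K n)) \<subseteq> - {?p h |h. h \<in> H}"
  proof
    fix x assume x: "x \<in> \<Inter> (range (\<lambda>n. - ?p ` K n))"
    show "x \<in> - {?p h |h. h \<in> H}"
    proof
      assume "x \<in> {?p h |h. h \<in> H}"
      then obtain h where h: "h \<in> H" "x = ?p h" by blast
      obtain n where "max (norm h) (norm (matrix_inv h)) \<le> real n" using real_arch_simple by blast
      then have "h \<in> K n" using h by (simp add: K_def)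
      with x h show False by blast
    qed
  qed
  ultimately have "UNIV \<subseteq> closure (- {?p h |h. h \<in> H})" using closure_mono by blast
  then have "{?p h |h. h \<in> H} = {}" using Orb by (auto simp: closure_complement interior_open)
  moreover have "mat 1 \<in> H" using H by (simp add: closed_subgroup_GL_def)
  ultimately show False by blast
qed

text \<open>
  Translating one compact set whose image has interior by the group gives open sets that cover the
  orbit, and finitely many of them cover \<open>A\<close>.
\<close>

lemma dual_orbit_compact_lift:
  fixes H :: "(real^'n^'n) set" and \<xi>0 :: "real^'n"
  assumes H: "closed_subgroup_GL H"
    and Orb: "open {transpose h *v \<xi>0 |h. h \<in> H}"
    and A: "compact A" "A \<subseteq> {transpose h *v \<xi>0 |h. h \<in> H}"
  shows "\<exists>C. compact C \<and> C \<subseteq> H \<and> A \<subseteq> (\<lambda>h. transpose h *v \<xi>0) ` C"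
proof -
  let ?p = "\<lambda>h. transpose h *v \<xi>0"
  have grp: "\<And>g h. g \<in> H \<Longrightarrow> h \<in> H \<Longrightarrow> g ** h \<in> H" "\<And>h. h \<in> H \<Longrightarrow> matrix_inv h \<in> H" "\<And>h. h \<in> H \<Longrightarrow> invertible h"
    using H by (auto simp: closed_subgroup_GL_def)
  obtain K where K: "compact K" "K \<subseteq> H" "interior (?p ` K) \<noteq> {}"
    using dual_orbit_map_image_interior[OF H Orb] by blast
  then obtain h0 where h0: "h0 \<in> K" "?p h0 \<in> interior (?p ` K)"
    using interior_subset by fast
  let ?I = "\<lambda>g. (*v) (transpose g) ` interior (?p ` K)"
  have op: "open (?I g)" if "g \<in> H" for g
  proof (rule open_surjective_linear_image)
    show "surj ((*v) (transpose g))"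
      by (rule surjI[of _ "(*v) (transpose (matrix_inv g))"])
        (rule transpose_vector_inverse[OF matrix_inv_inverse(2)[OF grp(3)[OF that]]])
  qed auto
  have cov: "A \<subseteq> (\<Union>g\<in>H. ?I g)"
  proof
    fix a assume "a \<in> A"
    then obtain g where g: "g \<in> H" "a = ?p g" using A by blast
    let ?k = "matrix_inv h0 ** g"
    have "h0 ** ?k = g"
      using grp(3)[of h0] h0 K(2) by (auto simp: matrix_mul_assoc matrix_inv_inverse)
    then have "a = transpose (h0 ** ?k) *v \<xi>0" using g by simp
    also have "\<dots> = transpose ?k *v ?p h0"
      by (simp only: matrix_vector_mul_assoc matrix_transpose_mul)
    finally have "a = transpose ?k *v ?p h0" .
    moreover have "?k \<in> H" using g h0 K(2) grp by blast
    ultimately show "a \<in> (\<Union>g\<in>H. ?I g)" using h0 by blast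
  qed
  obtain F where F: "F \<subseteq> H" "finite F" "A \<subseteq> (\<Union>g\<in>F. ?I g)"
    using compactE_image[OF A(1) op cov] by metis
  let ?C = "\<Union>g\<in>F. (\<lambda>h. h ** g) ` K"
  have "compact ?C"
    by (intro compact_UN F compact_continuous_image continuous_on_matrix_mult continuous_intros K)
  moreover have "?C \<subseteq> H" using F K grp by blast
  moreover have "A \<subseteq> ?p ` ?C"
  proof
    fix a assume "a \<in> A"
    then obtain g y where g: "g \<in> F" "y \<in> interior (?p ` K)" "a = transpose g *v y" using F by blast
    then obtain h where h: "h \<in> K" "y = ?p h" using interior_subset by blast
    have "a = ?p (h ** g)" using g h by (simp only: matrix_vector_mul_assoc matrix_transpose_mul)
    with g h show "a \<in> ?p ` ?C" by blast
  qed
  ultimately show ?thesis by blast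
qed

text \<open>
  Lift \<open>a\<close> and \<open>h\<^sup>T a\<close> to \<open>c\<close> and \<open>d\<close> in a compact set \<open>C\<close>. Then \<open>c h d\<^sup>-\<^sup>1\<close> stabilizes the base
  point, so \<open>h\<close> lies in the product of \<open>C\<^sup>-\<^sup>1\<close>, the stabilizer and \<open>C\<close>, which is compact.
\<close>

lemma dual_orbit_proper:
  fixes H :: "(real^'n^'n) set" and \<xi>0 :: "real^'n"
  assumes H: "closed_subgroup_GL H"
    and Orb: "open {transpose h *v \<xi>0 |h. h \<in> H}"
    and stab: "compact {h \<in> H. transpose h *v \<xi>0 = \<xi>0}"
    and A: "compact A" "A \<subseteq> {transpose h *v \<xi>0 |h. h \<in> H}"
  shows "\<exists>K. compact K \<and> K \<subseteq> H \<and> (\<forall>h\<in>H. \<forall>a\<in>A. transpose h *v a \<in> A \<longrightarrow> h \<in> K)"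
proof -
  let ?p = "\<lambda>h. transpose h *v \<xi>0" and ?S = "{h \<in> H. transpose h *v \<xi>0 = \<xi>0}"
  have grp: "\<And>g h. g \<in> H \<Longrightarrow> h \<in> H \<Longrightarrow> g ** h \<in> H" "\<And>h. h \<in> H \<Longrightarrow> matrix_inv h \<in> H" "\<And>h. h \<in> H \<Longrightarrow> invertible h"
    using H by (auto simp: closed_subgroup_GL_def)
  obtain C where C: "compact C" "C \<subseteq> H" "A \<subseteq> ?p ` C"
    using dual_orbit_compact_lift[OF H Orb A] by blast
  let ?f = "\<lambda>(c, s, d). matrix_inv c ** s ** d"
  let ?K = "?f ` (C \<times> ?S \<times> C)"
  have "continuous_on (C \<times> ?S \<times> C) ?f"
    unfolding case_prod_beta
  proof (intro continuous_on_matrix_mult)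
    show "continuous_on (C \<times> ?S \<times> C) (\<lambda>p. matrix_inv (fst p))"
      by (rule continuous_on_compose2[OF continuous_on_matrix_inv]) (use C grp in \<open>auto intro!: continuous_intros\<close>)
  qed (intro continuous_intros)+
  then have "compact ?K" by (intro compact_continuous_image compact_Times C stab)
  moreover have "?K \<subseteq> H"
  proof clarify
    fix c s d assume "c \<in> C" "s \<in> H" "d \<in> C"
    then show "matrix_inv c ** s ** d \<in> H" using C(2) by (intro grp) auto
  qed
  moreover have "h \<in> ?K" if h: "h \<in> H" and a: "a \<in> A" "transpose h *v a \<in> A" for h a
  proof -
    obtain c where c: "c \<in> C" "a = ?p c" using a C(3) by blast
    obtain d where d: "d \<in> C" "transpose h *v a = ?p d" using a C(3) by blast
    note ic = matrix_inv_inverse[OF grp(3)[OF subsetD[OF C(2) c(1)]]]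
    note id = matrix_inv_inverse[OF grp(3)[OF subsetD[OF C(2) d(1)]]]
    let ?s = "c ** h ** matrix_inv d"
    have "transpose ?s *v \<xi>0 = transpose (matrix_inv d) *v (transpose h *v (transpose c *v \<xi>0))"
      by (simp only: matrix_transpose_mul matrix_vector_mul_assoc matrix_mul_assoc)
    also have "\<dots> = transpose (matrix_inv d) *v (transpose d *v \<xi>0)"
      using c d by (simp only:)
    also have "\<dots> = \<xi>0" by (rule transpose_vector_inverse[OF id(1)])
    finally have s: "transpose ?s *v \<xi>0 = \<xi>0" .
    have "?s \<in> H" using h c(1) d(1) C(2) by (intro grp) auto
    with s have "?s \<in> ?S" by (simp only: mem_Collect_eq simp_thms)
    have "?f (c, ?s, d) = h"
    proof -
      have "matrix_inv c ** ?s ** d = (matrix_inv c ** c) ** h ** (matrix_inv d ** d)"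
        by (simp add: matrix_mul_assoc)
      also have "\<dots> = h" by (simp only: ic id matrix_mul_lid matrix_mul_rid)
      finally show ?thesis by (simp only: prod.case)
    qed
    then show ?thesis using c(1) d(1) \<open>?s \<in> ?S\<close> by (intro image_eqI[of _ _ "(c, ?s, d)"] SigmaI) (simp_all only:)
  qed
  ultimately show ?thesis by blast
qed

section \<open>Correlations and the wavelet transform\<close>

lemma borel_measurable_cnj[measurable (raw)]:
  assumes "f \<in> borel_measurable M"
  shows "(\<lambda>x. cnj (f x)) \<in> borel_measurable M"
  by (rule borel_measurable_continuous_on[OF _ assms]) (intro continuous_intros)

lemma norm_matrix_vector_mult_le:
  fixes A :: "real^'n^'m"
  shows "norm (A *v x) \<le> norm A * norm x"
proof -
  have "norm (A *v x) = L2_set (\<lambda>i. \<bar>A $ i \<bullet> x\<bar>) UNIV"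
    by (simp add: norm_vec_def matrix_vector_mul_component)
  also have "\<dots> \<le> L2_set (\<lambda>i. norm (A $ i) * norm x) UNIV"
    by (rule L2_set_mono) (simp_all add: Cauchy_Schwarz_ineq2)
  also have "\<dots> = norm A * norm x"
    by (simp add: L2_set_left_distrib norm_vec_def)
  finally show ?thesis .
qed

lemma invertible_uminus:
  fixes A :: "real^'n^'n"
  assumes "invertible A"
  shows "invertible (- A)"
  using scalar_invertible[OF _ assms, of "- 1"] by simp

lemma uminus_matrix_vector: "(- A) *v x = - (A *v (x :: real^'n))" for A :: "real^'n^'m"
  by (simp add: vec_eq_iff matrix_vector_mult_def sum_negf)

lemma ennreal_norm_integral_le: "ennreal (norm (integral\<^sup>L M f)) \<le> (\<integral>\<^sup>+x. ennreal (norm (f x)) \<partial>M)"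
  by (cases "integrable M f") (simp_all add: integral_norm_bound_ennreal not_integrable_integral_eq)

text \<open>
  The wavelet transform at \<open>(x, A)\<close> without its normalizing factor.
\<close>

definition correlation :: "real^'n^'n \<Rightarrow> (real^'n \<Rightarrow> complex) \<Rightarrow> (real^'n \<Rightarrow> complex) \<Rightarrow> real^'n \<Rightarrow> complex" where
  "correlation A u g x = (LINT y|lborel. u y * cnj (g (matrix_inv A *v (y - x))))"

text \<open>
  For fixed \<open>y\<close> the substitution \<open>x = y - A z\<close> turns the inner integral into a multiple of the
  integral of \<open>g\<close>. The sign explains the matrix \<open>- A\<close> in the scaling factors.
\<close>

lemma correlation_integrable:
  fixes A :: "real^'n^'n"
  assumes A: "invertible A" and u: "integrable lborel u" and g: "integrable lborel g"
  shows "integrable (lborel \<Otimes>\<^sub>M lborel) (\<lambda>(y, x). u y * cnj (g (matrix_inv A *v (y - x))))"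
proof -
  have [measurable]: "u \<in> borel_measurable borel" "g \<in> borel_measurable borel"
    using u g by (simp_all add: borel_measurable_integrable)
  let ?B = "matrix_inv A"
  have B: "invertible (- ?B)"
    by (rule invertible_uminus) (use matrix_inv_inverse[OF A] in \<open>auto simp: invertible_def\<close>)
  have gi: "integrable lborel (\<lambda>x. g (?B *v (y - x)))" for y
    using integrable_linear_affine[OF B g, of "?B *v y"]
    by (simp add: uminus_matrix_vector matrix_vector_mult_diff_distrib)
  have n: "(LINT x|lborel. norm (g (?B *v (y - x)))) = vol_scale (- A) * (LINT z|lborel. norm (g z))" for y
    using integral_linear_affine[OF invertible_uminus[OF A] integrable_norm[OF gi[of y]], of y]
    by (simp add: uminus_matrix_vector matrix_inv_vector[OF A])
  show ?thesis
  proof (rule lborel_pair.Fubini_integrable)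
    have "integrable lborel (\<lambda>y. norm (u y) * (vol_scale (- A) * (LINT z|lborel. norm (g z))))"
      using integrable_norm[OF u] by (rule integrable_mult_left)
    then show "integrable lborel (\<lambda>y. LINT x|lborel. norm (case (y, x) of (y, x) \<Rightarrow> u y * cnj (g (?B *v (y - x)))))"
      by (simp add: norm_mult n)
    show "AE y in lborel. integrable lborel (\<lambda>x. case (y, x) of (y, x) \<Rightarrow> u y * cnj (g (?B *v (y - x))))"
      using gi by simp
  qed measurable
qed

text \<open>
  The same substitution \<open>x = y - A z\<close> splits the character \<open>x \<mapsto> exp (-2 \<pi> i x \<cdot> \<xi>)\<close> into one in
  \<open>y\<close> at \<open>\<xi>\<close> and one in \<open>z\<close> at \<open>A\<^sup>T \<xi>\<close>.
\<close>

lemma fourier_correlation: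
  fixes A :: "real^'n^'n"
  assumes A: "invertible A" and u: "integrable lborel u" and g: "integrable lborel g"
  shows "integrable lborel (correlation A u g)"
    and "fourier (correlation A u g) \<xi> = vol_scale (- A) *\<^sub>R (fourier u \<xi> * cnj (fourier g (transpose A *v \<xi>)))"
proof -
  have [measurable]: "u \<in> borel_measurable borel" "g \<in> borel_measurable borel"
    using u g by (simp_all add: borel_measurable_integrable)
  let ?B = "matrix_inv A" and ?k = "vol_scale (- A)"
  let ?F = "\<lambda>y x. u y * cnj (g (?B *v (y - x)))"
  let ?e = "\<lambda>x. cis (- (2 * pi * (x \<bullet> \<xi>)))"
  note F = correlation_integrable[OF A u g]
  show "integrable lborel (correlation A u g)"
    using lborel_pair.integrable_snd[OF F] by (simp add: correlation_def[abs_def])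
  have Fe: "integrable (lborel \<Otimes>\<^sub>M lborel) (case_prod (\<lambda>y x. ?F y x * ?e x))"
    by (rule Bochner_Integration.integrable_bound[OF F]) (auto simp: norm_mult)
  have B: "invertible (- ?B)"
    by (rule invertible_uminus) (use matrix_inv_inverse[OF A] in \<open>auto simp: invertible_def\<close>)
  have gi: "integrable lborel (\<lambda>x. g (?B *v (y - x)))" for y
    using integrable_linear_affine[OF B g, of "?B *v y"]
    by (simp add: uminus_matrix_vector matrix_vector_mult_diff_distrib)
  have inner: "(LINT x|lborel. ?F y x * ?e x) = ?k *\<^sub>R (u y * ?e y * cnj (fourier g (transpose A *v \<xi>)))" for y
  proof -
    have i: "integrable lborel (\<lambda>x. cnj (g (?B *v (y - x))) * ?e x)"
      by (rule integrable_mult_cis) (use gi in simp_all)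
    have c: "cnj (g (?B *v (y - (y + (- A) *v z)))) * ?e (y + (- A) *v z)
        = ?e y * cnj (g z * cis (- (2 * pi * (z \<bullet> (transpose A *v \<xi>)))))" for z
    proof -
      have "?B *v (y - (y + (- A) *v z)) = z"
        by (simp add: uminus_matrix_vector matrix_inv_vector[OF A])
      moreover have "z \<bullet> (transpose A *v \<xi>) = (A *v z) \<bullet> \<xi>"
        by (metis dot_lmul_matrix inner_commute transpose_matrix_vector)
      then have "?e (y + (- A) *v z) = ?e y * cnj (cis (- (2 * pi * (z \<bullet> (transpose A *v \<xi>)))))"
        by (simp only: cis_cnj cis_mult uminus_matrix_vector) (simp add: algebra_simps)
      ultimately show ?thesis by (simp only: complex_cnj_mult mult_ac)
    qed
    have "(LINT x|lborel. ?F y x * ?e x) = u y * (LINT x|lborel. cnj (g (?B *v (y - x))) * ?e x)"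
      by (simp only: mult.assoc integral_mult_right_zero)
    also have "(LINT x|lborel. cnj (g (?B *v (y - x))) * ?e x)
        = ?k *\<^sub>R (LINT z|lborel. ?e y * cnj (g z * cis (- (2 * pi * (z \<bullet> (transpose A *v \<xi>))))))"
      unfolding c[symmetric] by (rule integral_linear_affine[OF invertible_uminus[OF A] i])
    also have "(LINT z|lborel. ?e y * cnj (g z * cis (- (2 * pi * (z \<bullet> (transpose A *v \<xi>))))))
        = ?e y * cnj (fourier g (transpose A *v \<xi>))"
      unfolding fourier_cis integral_mult_right_zero Bochner_Integration.integral_cnj ..
    finally show ?thesis by (simp only: scaleR_conv_of_real mult_ac)
  qed
  have "fourier (correlation A u g) \<xi> = (LINT x|lborel. (LINT y|lborel. ?F y x * ?e x))"
    unfolding fourier_cis[of _ \<xi>] correlation_def by (simp only: integral_mult_left_zero)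
  also have "\<dots> = (LINT y|lborel. (LINT x|lborel. ?F y x * ?e x))"
    by (rule lborel_pair.Fubini_integral[OF Fe])
  also have "\<dots> = ?k *\<^sub>R (fourier u \<xi> * cnj (fourier g (transpose A *v \<xi>)))"
    unfolding inner fourier_cis[of u] integral_scaleR_right integral_mult_left_zero ..
  finally show "fourier (correlation A u g) \<xi> = ?k *\<^sub>R (fourier u \<xi> * cnj (fourier g (transpose A *v \<xi>)))" .
qed

lemma correlation_AE_eq_0:
  fixes A :: "real^'n^'n"
  assumes A: "invertible A" and u: "integrable lborel u" and g: "integrable lborel g"
    and z: "\<And>\<xi>. fourier u \<xi> = 0 \<or> fourier g (transpose A *v \<xi>) = 0"
  shows "AE x in lborel. correlation A u g x = 0"
proof (rule fourier_injective[OF fourier_correlation(1)[OF A u g]])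
  show "fourier (correlation A u g) \<xi> = 0" for \<xi>
    unfolding fourier_correlation(2)[OF A u g] using z[of \<xi>] by (auto simp del: transpose_matrix_vector)
qed

text \<open>
  Young's inequality for a submultiplicative weight: after \<open>x = y - A z\<close> the weight of \<open>x\<close> is at
  most the weight of \<open>y\<close> times that of \<open>z\<close> times \<open>(1 + \<bar>A\<bar>)\<^sup>s\<close>.
\<close>

lemma correlation_weighted_norm:
  fixes A :: "real^'n^'n"
  assumes A: "invertible A" and [measurable]: "u \<in> borel_measurable borel" "g \<in> borel_measurable borel"
    and s: "0 \<le> s"
  shows "(\<integral>\<^sup>+x. ennreal (norm (correlation A u g x) * (1 + norm x) powr s) \<partial>lborel)
    \<le> ennreal (vol_scale (- A) * (1 + norm A) powr s)
      * ((\<integral>\<^sup>+y. ennreal (norm (u y) * (1 + norm y) powr s) \<partial>lborel) * (\<integral>\<^sup>+z. ennreal (norm (g z) * (1 + norm z) powr s) \<partial>lborel))"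
proof -
  let ?B = "matrix_inv A" and ?k = "vol_scale (- A)" and ?p = "\<lambda>x::real^'n. (1 + norm x) powr s"
  let ?a = "(1 + norm A) powr s"
  have k: "0 < ?k" by (rule vol_scale_pos[OF invertible_uminus[OF A]])
  have p: "?p (y + (- A) *v z) \<le> ?p y * (?a * ?p z)" for y z
  proof -
    have "norm (y + (- A) *v z) \<le> norm y + norm A * norm z"
      using norm_triangle_ineq4[of y "A *v z"] norm_matrix_vector_mult_le[of A z]
      by (simp add: uminus_matrix_vector)
    then have "1 + norm (y + (- A) *v z) \<le> (1 + norm y) * ((1 + norm A) * (1 + norm z))"
    proof -
      have "(1 + norm y) * ((1 + norm A) * (1 + norm z)) = 1 + norm y + norm A * norm z
          + (norm A + norm z + norm y * norm A + norm y * norm z + norm y * (norm A * norm z))"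
        by (simp add: algebra_simps)
      moreover have "0 \<le> norm A + norm z + norm y * norm A + norm y * norm z + norm y * (norm A * norm z)"
        by (intro add_nonneg_nonneg mult_nonneg_nonneg norm_ge_zero)
      moreover note \<open>norm (y + (- A) *v z) \<le> norm y + norm A * norm z\<close>
      ultimately show ?thesis by linarith
    qed
    then have "?p (y + (- A) *v z) \<le> ((1 + norm y) * ((1 + norm A) * (1 + norm z))) powr s"
      by (intro powr_mono2 s) auto
    then show ?thesis by (simp add: powr_mult)
  qed
  have "(\<integral>\<^sup>+x. ennreal (norm (correlation A u g x) * ?p x) \<partial>lborel)
      \<le> (\<integral>\<^sup>+x. (\<integral>\<^sup>+y. ennreal (norm (u y)) * ennreal (norm (g (?B *v (y - x))) * ?p x) \<partial>lborel) \<partial>lborel)"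
  proof (rule nn_integral_mono)
    fix x
    have "ennreal (norm (correlation A u g x) * ?p x) = ennreal (norm (correlation A u g x)) * ennreal (?p x)"
      by (simp add: ennreal_mult)
    also have "\<dots> \<le> (\<integral>\<^sup>+y. ennreal (norm (u y * cnj (g (?B *v (y - x))))) \<partial>lborel) * ennreal (?p x)"
      unfolding correlation_def by (rule mult_right_mono[OF ennreal_norm_integral_le]) simp
    also have "\<dots> = (\<integral>\<^sup>+y. ennreal (norm (u y)) * ennreal (norm (g (?B *v (y - x))) * ?p x) \<partial>lborel)"
      by (subst nn_integral_multc[symmetric]) (simp_all add: norm_mult ennreal_mult mult.assoc)
    finally show "ennreal (norm (correlation A u g x) * ?p x) \<le> (\<integral>\<^sup>+y. ennreal (norm (u y)) * ennreal (norm (g (?B *v (y - x))) * ?p x) \<partial>lborel)" .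
  qed
  also have "\<dots> = (\<integral>\<^sup>+y. (\<integral>\<^sup>+x. ennreal (norm (u y)) * ennreal (norm (g (?B *v (y - x))) * ?p x) \<partial>lborel) \<partial>lborel)"
    by (rule lborel_pair.Fubini'[symmetric]) measurable
  also have "\<dots> \<le> (\<integral>\<^sup>+y. ennreal (norm (u y) * ?p y) * (ennreal (?k * ?a) * (\<integral>\<^sup>+z. ennreal (norm (g z) * ?p z) \<partial>lborel)) \<partial>lborel)"
  proof (rule nn_integral_mono)
    fix y
    have "(\<integral>\<^sup>+x. ennreal (norm (u y)) * ennreal (norm (g (?B *v (y - x))) * ?p x) \<partial>lborel)
        = ennreal ?k * (\<integral>\<^sup>+z. ennreal (norm (u y)) * ennreal (norm (g (?B *v (y - (y + (- A) *v z)))) * ?p (y + (- A) *v z)) \<partial>lborel)"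
      by (rule nn_integral_linear_affine[OF invertible_uminus[OF A]]) measurable
    also have "\<dots> = ennreal ?k * (\<integral>\<^sup>+z. ennreal (norm (u y)) * ennreal (norm (g z) * ?p (y + (- A) *v z)) \<partial>lborel)"
      by (simp add: uminus_matrix_vector matrix_inv_vector[OF A])
    also have "\<dots> \<le> ennreal ?k * (\<integral>\<^sup>+z. ennreal (norm (u y) * ?p y * ?a) * ennreal (norm (g z) * ?p z) \<partial>lborel)"
    proof (intro mult_left_mono nn_integral_mono)
      fix z
      have "norm (u y) * (norm (g z) * ?p (y + (- A) *v z)) \<le> norm (u y) * (norm (g z) * (?p y * (?a * ?p z)))"
        by (intro mult_left_mono p) auto
      then show "ennreal (norm (u y)) * ennreal (norm (g z) * ?p (y + (- A) *v z)) \<le> ennreal (norm (u y) * ?p y * ?a) * ennreal (norm (g z) * ?p z)"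
        by (simp add: ennreal_mult[symmetric] ennreal_leI mult_ac)
    qed simp
    also have "\<dots> = ennreal (norm (u y) * ?p y) * (ennreal (?k * ?a) * (\<integral>\<^sup>+z. ennreal (norm (g z) * ?p z) \<partial>lborel))"
      using k by (subst nn_integral_cmult) (simp_all add: ennreal_mult mult_ac)
    finally show "(\<integral>\<^sup>+x. ennreal (norm (u y)) * ennreal (norm (g (?B *v (y - x))) * ?p x) \<partial>lborel)
        \<le> ennreal (norm (u y) * ?p y) * (ennreal (?k * ?a) * (\<integral>\<^sup>+z. ennreal (norm (g z) * ?p z) \<partial>lborel))" .
  qed
  also have "\<dots> = ennreal (?k * ?a) * ((\<integral>\<^sup>+y. ennreal (norm (u y) * ?p y) \<partial>lborel) * (\<integral>\<^sup>+z. ennreal (norm (g z) * ?p z) \<partial>lborel))"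
    by (subst nn_integral_multc) (measurable, simp only: mult_ac)
  finally show ?thesis .
qed

lemma wavelet_transform_correlation:
  "wavelet_transform \<psi> f (x, h) = of_real (\<bar>det h\<bar> powr (- 1 / 2)) * correlation h f \<psi> x"
  unfolding wavelet_transform_def L2_inner_def qreg_def correlation_def
  by (subst integral_mult_right_zero[symmetric]) (simp add: mult_ac)

lemma left_Haar_measure_space:
  assumes "left_Haar_measure H \<mu>"
  shows "space \<mu> = H"
  using assms sets_eq_imp_space_eq[of \<mu> "restrict_space borel H"] by (simp add: left_Haar_measure_def space_restrict_space)

lemma wavelet_transform_measurable:
  fixes H :: "(real^'n^'n) set"
  assumes H: "closed_subgroup_GL H" and \<mu>: "left_Haar_measure H \<mu>"
    and [measurable]: "f \<in> borel_measurable borel" "\<psi> \<in> borel_measurable borel"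
  shows "wavelet_transform \<psi> f \<in> borel_measurable (Haar_G \<mu>)"
proof -
  have s: "sets \<mu> = sets (restrict_space borel H)" using \<mu> by (simp add: left_Haar_measure_def)
  have GL: "H \<subseteq> {h. invertible h}" using H by (simp add: closed_subgroup_GL_def)
  have inv: "matrix_inv \<in> borel_measurable \<mu>"
    unfolding measurable_cong_sets[OF s refl]
    by (rule borel_measurable_continuous_on_restrict[OF continuous_on_subset[OF continuous_on_matrix_inv GL]])
  have det: "det \<in> borel_measurable \<mu>"
    unfolding measurable_cong_sets[OF s refl]
    by (rule borel_measurable_continuous_on_restrict) (intro continuous_on_det continuous_intros)
  let ?N = "((lborel :: (real^'n) measure) \<Otimes>\<^sub>M \<mu>) \<Otimes>\<^sub>M (lborel :: (real^'n) measure)"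
  have 1: "(\<lambda>z. matrix_inv (snd (fst z))) \<in> borel_measurable ?N"
    by (rule measurable_compose[OF measurable_compose[OF measurable_fst measurable_snd] inv])
  have "(\<lambda>z. fst (fst z)) \<in> measurable ?N lborel"
    by (rule measurable_compose[OF measurable_fst measurable_fst])
  then have fst: "(\<lambda>z. fst (fst z)) \<in> borel_measurable ?N" by (simp only: measurable_lborel1)
  have "snd \<in> measurable ?N lborel" by (rule measurable_snd)
  then have snd: "snd \<in> borel_measurable ?N" by (simp only: measurable_lborel1)
  have 2: "(\<lambda>z. snd z - fst (fst z)) \<in> borel_measurable ?N"
    by (rule borel_measurable_diff[OF snd fst])
  have 3: "(\<lambda>z. matrix_inv (snd (fst z)) *v (snd z - fst (fst z))) \<in> borel_measurable ?N"
    by (rule borel_measurable_continuous_Pair[OF 1 2])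
      (intro continuous_on_matrix_vector_mult continuous_intros)
  have "(\<lambda>z. f (snd z) * cnj (\<psi> (matrix_inv (snd (fst z)) *v (snd z - fst (fst z))))) \<in> borel_measurable ?N"
    by (intro borel_measurable_times borel_measurable_cnj measurable_compose[OF snd] measurable_compose[OF 3] assms(3,4))
  then have 4: "(\<lambda>g. LINT y|lborel. f y * cnj (\<psi> (matrix_inv (snd g) *v (y - fst g)))) \<in> borel_measurable (lborel \<Otimes>\<^sub>M \<mu>)"
    by (intro sigma_finite_measure.borel_measurable_lebesgue_integral[OF sigma_finite_lborel]) (simp only: case_prod_beta')
  have 5: "(\<lambda>g. complex_of_real (\<bar>det (snd g)\<bar> powr (- 1 / 2))) \<in> borel_measurable (lborel \<Otimes>\<^sub>M \<mu>)"
    by (rule measurable_compose[OF measurable_compose[OF measurable_snd det]]) measurable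
  have eq: "wavelet_transform \<psi> f = (\<lambda>g. of_real (\<bar>det (snd g)\<bar> powr (- 1 / 2))
      * (LINT y|lborel. f y * cnj (\<psi> (matrix_inv (snd g) *v (y - fst g)))))"
    unfolding fun_eq_iff split_paired_All wavelet_transform_correlation correlation_def by simp
  have "wavelet_transform \<psi> f \<in> borel_measurable (lborel \<Otimes>\<^sub>M \<mu>)"
    unfolding eq by (rule borel_measurable_times[OF 5 4])
  then show ?thesis by (simp add: Haar_G_def)
qed

text \<open>
  The inner integral vanishes unless \<open>h\<close> lies in the compact set \<open>K\<close> on which \<open>h\<^sup>T\<close> can return the
  support of the Fourier transform of \<open>\<psi>\<close> to itself, and on \<open>K\<close> it is bounded by a constant \<open>M\<close>,
  as every factor of the estimate is continuous in \<open>h\<close> or bounded on \<open>K\<close>.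
\<close>

theorem wavelet_transform_L1_weighted:
  fixes H :: "(real^'n^'n) set"
  assumes H: "closed_subgroup_GL H" and \<mu>: "left_Haar_measure H \<mu>" and Orb: "open_dual_orbit H Orb"
    and w: "weight_on H (**) w" and s: "0 \<le> s"
    and v: "\<And>x h. h \<in> H \<Longrightarrow> v (x, h) \<le> (1 + norm x) powr s * w h"
    and \<psi>: "\<psi> \<in> Finv_Cc_infinity Orb"
  shows "wavelet_transform \<psi> \<psi> \<in> L1_weighted \<mu> v"
proof -
  have i: "integrable lborel \<psi>" and f: "fourier \<psi> \<in> Cc_infinity Orb"
    using \<psi> by (auto simp: Finv_Cc_infinity_def)
  have [measurable]: "\<psi> \<in> borel_measurable borel" using i by (simp add: borel_measurable_integrable)
  have GL: "\<And>h. h \<in> H \<Longrightarrow> invertible h" using H by (auto simp: closed_subgroup_GL_def)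
  define I where "I = (LINT y|lborel. norm (\<psi> y) * (1 + norm y) powr s)"
  have I: "(\<integral>\<^sup>+y. ennreal (norm (\<psi> y) * (1 + norm y) powr s) \<partial>lborel) = ennreal I" "0 \<le> I"
  proof -
    have "integrable lborel (\<lambda>y. norm (\<psi> y) * (1 + norm y) powr s)"
      using Finv_Cc_infinity_moments[OF \<psi>, of s] by (simp only: mult.commute)
    then show "(\<integral>\<^sup>+y. ennreal (norm (\<psi> y) * (1 + norm y) powr s) \<partial>lborel) = ennreal I"
      unfolding I_def by (rule nn_integral_eq_integral) simp
    show "0 \<le> I" unfolding I_def by (rule integral_nonneg_AE) simp
  qed
  let ?A = "closure {\<xi>. fourier \<psi> \<xi> \<noteq> 0}"
  obtain \<xi>0 where \<xi>0: "Orb = {transpose h *v \<xi>0 |h. h \<in> H}" "open Orb" "compact {h \<in> H. transpose h *v \<xi>0 = \<xi>0}"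
    using Orb unfolding open_dual_orbit_def by blast
  have A: "compact ?A" "?A \<subseteq> Orb" using f unfolding Cc_infinity_def by blast+
  obtain K where K: "compact K" "K \<subseteq> H" "\<forall>h\<in>H. \<forall>a\<in>?A. transpose h *v a \<in> ?A \<longrightarrow> h \<in> K"
    using dual_orbit_proper[OF H \<xi>0(2)[unfolded \<xi>0(1)] \<xi>0(3) A(1) A(2)[unfolded \<xi>0(1)]] by blast
  have off: "AE x in lborel. wavelet_transform \<psi> \<psi> (x, h) = 0" if h: "h \<in> H" "h \<notin> K" for h
  proof -
    have "fourier \<psi> \<xi> = 0 \<or> fourier \<psi> (transpose h *v \<xi>) = 0" for \<xi>
      using K(3)[rule_format, OF h(1), of \<xi>] h(2) closure_subset[of "{\<xi>. fourier \<psi> \<xi> \<noteq> 0}"] by blast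
    from correlation_AE_eq_0[OF GL[OF h(1)] i i this]
    show ?thesis by eventually_elim (simp add: wavelet_transform_correlation)
  qed
  have bdd: "\<exists>B\<ge>0. \<forall>h\<in>K. q h \<le> B" if "continuous_on K q" for q :: "real^'n^'n \<Rightarrow> real"
  proof -
    have "bounded (q ` K)" by (rule compact_imp_bounded[OF compact_continuous_image[OF that K(1)]])
    then obtain B where "\<forall>h\<in>K. \<bar>q h\<bar> \<le> B" by (auto simp: bounded_iff)
    then show ?thesis by (intro exI[of _ "max B 0"]) (auto simp: le_max_iff_disj)
  qed
  obtain R where R: "0 \<le> R" "\<forall>h\<in>K. norm h \<le> R"
    using bdd[OF continuous_on_norm[OF continuous_on_id]] by blast
  have cd: "continuous_on K det" by (intro continuous_on_det continuous_intros)
  have dn: "det h \<noteq> 0" if "h \<in> K" for h using GL K(2) that by (auto simp: invertible_det_nz[symmetric])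
  have "continuous_on K w" using w K(2) by (auto simp: weight_on_def intro: continuous_on_subset)
  then have "continuous_on K (\<lambda>h. w h * \<bar>det h\<bar> powr (- 1 / 2) * (1 / \<bar>det h\<bar>))"
    by (intro continuous_intros cd) (use dn in auto)
  then obtain Q where Q: "0 \<le> Q" "\<forall>h\<in>K. w h * \<bar>det h\<bar> powr (- 1 / 2) * (1 / \<bar>det h\<bar>) \<le> Q"
    using bdd by blast
  \<comment> \<open>On \<open>K\<close>, the norm of \<open>h\<close> is at most \<open>R\<close>, which bounds the volume scaling by \<open>?V\<close>; \<open>Q\<close> collects the weight and the determinants.\<close>
  let ?V = "measure lborel (cball (0::real^'n) (R * CARD('n)))"
  define M where "M = Q * ((?V * (1 + R) powr s) * (I * I))"
  have on: "(\<integral>\<^sup>+x. ennreal (cmod (wavelet_transform \<psi> \<psi> (x, h)) * v (x, h)) \<partial>lborel) * ennreal (1 / \<bar>det h\<bar>) \<le> ennreal M"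
    if h: "h \<in> K" for h
  proof -
    have hH: "h \<in> H" using h K(2) by blast
    have [measurable]: "correlation h \<psi> \<psi> \<in> borel_measurable borel"
      using fourier_correlation(1)[OF GL[OF hH] i i] by (simp add: borel_measurable_integrable)
    have wp: "0 < w h" using w hH by (simp add: weight_on_def)
    let ?d = "\<bar>det h\<bar> powr (- 1 / 2)"
    have "(\<integral>\<^sup>+x. ennreal (cmod (wavelet_transform \<psi> \<psi> (x, h)) * v (x, h)) \<partial>lborel)
        \<le> (\<integral>\<^sup>+x. ennreal (w h * ?d) * ennreal (norm (correlation h \<psi> \<psi> x) * (1 + norm x) powr s) \<partial>lborel)"
    proof (rule nn_integral_mono)
      fix x
      have "cmod (wavelet_transform \<psi> \<psi> (x, h)) * v (x, h) \<le> (?d * norm (correlation h \<psi> \<psi> x)) * ((1 + norm x) powr s * w h)"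
        unfolding wavelet_transform_correlation norm_mult norm_of_real
        by (simp add: mult_left_mono v[OF hH])
      also have "\<dots> = (w h * ?d) * (norm (correlation h \<psi> \<psi> x) * (1 + norm x) powr s)"
        by (simp only: mult_ac)
      finally have "ennreal (cmod (wavelet_transform \<psi> \<psi> (x, h)) * v (x, h))
          \<le> ennreal ((w h * ?d) * (norm (correlation h \<psi> \<psi> x) * (1 + norm x) powr s))"
        by (rule ennreal_leI)
      also have "\<dots> = ennreal (w h * ?d) * ennreal (norm (correlation h \<psi> \<psi> x) * (1 + norm x) powr s)"
        by (rule ennreal_mult) (use wp in simp_all)
      finally show "ennreal (cmod (wavelet_transform \<psi> \<psi> (x, h)) * v (x, h))
          \<le> ennreal (w h * ?d) * ennreal (norm (correlation h \<psi> \<psi> x) * (1 + norm x) powr s)" .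
    qed
    also have "\<dots> = ennreal (w h * ?d) * (\<integral>\<^sup>+x. ennreal (norm (correlation h \<psi> \<psi> x) * (1 + norm x) powr s) \<partial>lborel)"
      by (rule nn_integral_cmult) measurable
    also have "\<dots> \<le> ennreal (w h * ?d) * (ennreal (vol_scale (- h) * (1 + norm h) powr s) * (ennreal I * ennreal I))"
      using correlation_weighted_norm[OF GL[OF hH] _ _ s, of \<psi> \<psi>] unfolding I(1) by (intro mult_left_mono) simp_all
    also have "\<dots> \<le> ennreal (w h * ?d) * (ennreal (?V * (1 + R) powr s) * (ennreal I * ennreal I))"
    proof (intro mult_left_mono mult_right_mono ennreal_leI mult_mono powr_mono2 s)
      show "vol_scale (- h) \<le> ?V"
      proof (rule vol_scale_le[OF _ R(1)])
        show "norm (- h *v x) \<le> R * norm x" for x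
          using norm_matrix_vector_mult_le[of "- h" x] mult_right_mono[OF bspec[OF R(2) h], of "norm x"] by simp
      qed
    qed (use R h in simp_all)
    finally have "(\<integral>\<^sup>+x. ennreal (cmod (wavelet_transform \<psi> \<psi> (x, h)) * v (x, h)) \<partial>lborel) * ennreal (1 / \<bar>det h\<bar>)
        \<le> ennreal (w h * ?d) * (ennreal (?V * (1 + R) powr s) * (ennreal I * ennreal I)) * ennreal (1 / \<bar>det h\<bar>)"
      by (rule mult_right_mono) simp
    also have "\<dots> = ennreal ((w h * ?d * (1 / \<bar>det h\<bar>)) * ((?V * (1 + R) powr s) * (I * I)))"
    proof -
      have nn: "0 \<le> w h * ?d" "0 \<le> 1 / \<bar>det h\<bar>" "0 \<le> ?V * (1 + R) powr s" "0 \<le> I"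
        using wp I(2) by simp_all
      show ?thesis by (simp only: ennreal_mult nn mult_nonneg_nonneg) (simp only: mult_ac)
    qed
    also have "\<dots> \<le> ennreal M"
      unfolding M_def by (intro ennreal_leI mult_right_mono bspec[OF Q(2) h]) (simp add: I(2))
    finally show ?thesis .
  qed
  have Ks: "K \<in> sets \<mu>"
  proof -
    have "H \<inter> K \<in> sets (restrict_space borel H)"
      unfolding sets_restrict_space by (rule imageI[OF borel_compact[OF K(1)]])
    then show ?thesis using K(2) \<mu> by (simp add: left_Haar_measure_def Int_absorb1)
  qed
  have "(\<integral>\<^sup>+h. (\<integral>\<^sup>+x. ennreal (cmod (wavelet_transform \<psi> \<psi> (x, h)) * v (x, h)) \<partial>lborel) * ennreal (1 / \<bar>det h\<bar>) \<partial>\<mu>)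
      \<le> (\<integral>\<^sup>+h. ennreal M * indicator K h \<partial>\<mu>)"
  proof (rule nn_integral_mono)
    fix h assume "h \<in> space \<mu>"
    then have h: "h \<in> H" by (simp add: left_Haar_measure_space[OF \<mu>])
    show "(\<integral>\<^sup>+x. ennreal (cmod (wavelet_transform \<psi> \<psi> (x, h)) * v (x, h)) \<partial>lborel) * ennreal (1 / \<bar>det h\<bar>) \<le> ennreal M * indicator K h"
    proof (cases "h \<in> K")
      case True
      then show ?thesis using on[OF True] by simp
    next
      case False
      have "(\<integral>\<^sup>+x. ennreal (cmod (wavelet_transform \<psi> \<psi> (x, h)) * v (x, h)) \<partial>lborel) = (\<integral>\<^sup>+x. 0 \<partial>(lborel :: (real^'n) measure))"
        by (rule nn_integral_cong_AE) (use off[OF h False] in eventually_elim, simp)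
      then show ?thesis by simp
    qed
  qed
  also have "\<dots> = ennreal M * emeasure \<mu> K" using Ks by (simp add: nn_integral_cmult)
  also have "\<dots> < \<infinity>"
  proof -
    have "emeasure \<mu> K < \<infinity>" using K(1,2) \<mu> unfolding left_Haar_measure_def by blast
    then show ?thesis by (simp add: ennreal_mult_less_top)
  qed
  finally show ?thesis
    using wavelet_transform_measurable[OF H \<mu>, of \<psi> \<psi>] by (simp add: L1_weighted_def)
qed

text \<open>
  The inverse Fourier transform of a bump is bounded and integrable, hence square-integrable, and
  it cannot vanish almost everywhere since the bump can be recovered from it.
\<close>

lemma Finv_Cc_infinity_nonzero_L2:
  fixes U :: "(real^'n) set"
  assumes "open U" "U \<noteq> {}"
  shows "\<exists>\<psi>\<in>Finv_Cc_infinity U. \<psi> \<in> L2 lborel \<and> \<not> (AE x in lborel. \<psi> x = 0)"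
proof -
  obtain a where "a \<in> U" using assms(2) by blast
  then obtain f where f: "f \<in> Cc_infinity U" "f a \<noteq> 0"
    using Cc_infinity_nonzero[OF assms(1)] by blast
  let ?p = "inv_fourier f"
  have i: "integrable lborel ?p" by (rule inv_fourier_integrable[OF f(1)])
  have [measurable]: "?p \<in> borel_measurable borel" using i by (simp add: borel_measurable_integrable)
  have inv: "fourier ?p = f" by (rule Cc_infinity_fourier_inversion[OF f(1)])
  have "?p \<in> Finv_Cc_infinity U" using i inv f(1) by (simp add: Finv_Cc_infinity_def)
  moreover have "?p \<in> L2 lborel"
  proof -
    let ?B = "LINT \<xi>|lborel. norm (f \<xi>)"
    have "integrable lborel (\<lambda>x. (cmod (?p x))\<^sup>2)"
    proof (rule Bochner_Integration.integrable_bound)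
      show "integrable lborel (\<lambda>x. ?B * norm (?p x))" by (intro integrable_mult_right integrable_norm i)
      show "AE x in lborel. norm ((cmod (?p x))\<^sup>2) \<le> norm (?B * norm (?p x))"
        using norm_inv_fourier_le[of f] by (auto simp: power2_eq_square abs_mult intro!: mult_right_mono)
    qed measurable
    then show ?thesis by (simp add: L2_def)
  qed
  moreover have "\<not> (AE x in lborel. ?p x = 0)"
  proof
    assume "AE x in lborel. ?p x = 0"
    then have "AE x in lborel. ?p x * cis (- (2 * pi * (x \<bullet> a))) = 0" by eventually_elim simp
    then have "fourier ?p a = 0" unfolding fourier_cis by (rule integral_eq_zero_AE)
    then show False using f(2) inv by simp
  qed
  ultimately show ?thesis by (intro bexI[of _ ?p] conjI)
qed

theorem theorem2p1:
  fixes H :: "(real^'n^'n) set"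
    and \<mu> :: "(real^'n^'n) measure"
    and Orb :: "(real^'n) set"
    and v :: "(real^'n) \<times> (real^'n^'n) \<Rightarrow> real"
    and w :: "real^'n^'n \<Rightarrow> real"
    and s :: real
  assumes "1 < CARD('n)"
    and "admissible_dilation_group H \<mu>"
    and "open_dual_orbit H Orb"
    and "weight_on (UNIV \<times> H) sd_mult v"
    and "weight_on H (**) w"
    and "0 \<le> s"
    and "\<And>x h. h \<in> H \<Longrightarrow> v (x, h) \<le> (1 + norm x) powr s * w h"
  shows "v_integrable \<mu> v \<and>
    (\<forall>\<psi> \<in> Finv_Cc_infinity Orb. wavelet_transform \<psi> \<psi> \<in> L1_weighted \<mu> v)"
proof -
  have H: "closed_subgroup_GL H" and \<mu>: "left_Haar_measure H \<mu>"
    using assms(2) by (auto simp: admissible_dilation_group_def)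
  have all: "wavelet_transform \<psi> \<psi> \<in> L1_weighted \<mu> v" if "\<psi> \<in> Finv_Cc_infinity Orb" for \<psi>
    by (rule wavelet_transform_L1_weighted[OF H \<mu> assms(3,5,6,7) that])
  have "mat 1 \<in> H" using H by (simp add: closed_subgroup_GL_def)
  then have "open Orb" "Orb \<noteq> {}" using assms(3) unfolding open_dual_orbit_def by blast+
  from Finv_Cc_infinity_nonzero_L2[OF this] have "v_integrable \<mu> v"
    using all unfolding v_integrable_def by blast
  with all show ?thesis by blast
qed

end
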